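(* Consider the constrained convex program and its standing assumptions (i)–(iv) described in the context, and let $\{(x^k,z^k)\}$ be generated by the single-loop algorithm described in the context, where the parameters satisfy the following conditions: the positive sequence $\{\lambda_k\}$ is increasing, $\lambda_k=\Theta(k^{\tau})$ and $\lambda_{k+1}-\lambda_k=\mathcal{O}(k^{-(1-\tau)})$ for some $\tau\in(0,1)$; for every $k$, $\alpha_k$ is the short stepsize (defined in the context) at $(x^k,z^k,v^k,\lambda_k)$; and the positive sequence $\{\sigma_k\}$ satisfies $\sigma_k\le\lambda_k$ and $\sigma_k=\Theta(k^{-(1+\gamma)})$ for some $\gamma>0$. Let $L^*$ be the optimal value of the program. Then $$\max\{|f(x^k)+h(x^k)-L^*|,\ \|[g(x^k)]_+\|\}=\mathcal{O}(\max\{k^{-1/2},k^{-(1-\tau)},k^{-\tau}\}).$$ If, in addition, the program has a Slater point (i.e., there is $\tilde x\in\mathrm{dom}\,h$ with $g_i(\tilde x)<0$ for all $i$), then there exists a subsequence of $\{(x^k,[\lambda_k g(x^k)+z^k]_+)\}$ such that all of its cluster points are KKT points of the program.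
   Context: Conventions: $\|\cdot\|$ is the Euclidean norm, vector inequalities and maxima are componentwise, $[a]_+=\max\{a,0\}$ (componentwise for vectors), $\mathrm{dom}\,h=\{x:h(x)<\infty\}$. Asymptotic notation is as $k\to\infty$. Problem: $\min_{x\in\mathbb{R}^n} f(x)+h(x)$ subject to $g(x):=(g_1(x),\dots,g_m(x))^T\le 0$. Standing assumptions: (i) $f:\mathbb{R}^n\to\mathbb{R}$ is convex and differentiable with $L_f$-Lipschitz gradient, $L_f>0$. (ii) $h:\mathbb{R}^n\to(-\infty,+\infty]$ is proper, closed, convex, $\sup_{x,x'\in\mathrm{dom}\,h}\|x-x'\|\le D$ for some finite $D>0$, and for every $u\in\mathbb{R}^n$ the problem $\min_v\langle v,u\rangle+h(v)$ has a minimizer. (iii) Each $g_i:\mathbb{R}^n\to\mathbb{R}$ is convex and differentiable, and there is $L_{g_i}>0$ with $\|\nabla g_i(x)-\nabla g_i(x')\|\le L_{g_i}\|x-x'\|$ for all $x,x'\in\mathrm{dom}\,h$. (iv) There is a KKT point $(x^*,z^* )$: $0\in\nabla f(x^* )+\partial h(x^* )+\sum_{i=1}^m z_i^*\nabla g_i(x^* )$, $g(x^* )\le 0$, $z^*\ge 0$, $\langle z^*,g(x^* )\rangle=0$. Fix constants $B_i>0$ with $\|\nabla g_i(x)\|\le B_i$ and $|g_i(x)-g_i(x')|\le B_i\|x-x'\|$ for all $x,x'\in\mathrm{dom}\,h$ (these exist under the assumptions). For $\lambda>0$, let $\Psi_\lambda(x,z)=\frac{\lambda}{2}\sum_{i=1}^m\big([g_i(x)+z_i/\lambda]_+^2-(z_i/\lambda)^2\big)$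 and $F_\lambda(x,z)=f(x)+\Psi_\lambda(x,z)$, so $\nabla_xF_\lambda(x,z)=\nabla f(x)+\sum_{i=1}^m[\lambda g_i(x)+z_i]_+\nabla g_i(x)$. Let $L_\Psi(x,z)=\sum_{i=1}^m(\lambda B_i^2+L_{g_i}[\lambda g_i(x)+z_i]_+)$ (depending on $\lambda$; $L_\Psi(x^k,z^k)$ is taken with $\lambda=\lambda_k$). Gap function: $G_{z,\lambda}(x)=\langle\nabla_xF_\lambda(x,z),x-v^+\rangle+h(x)-h(v^+)$ for any $v^+\in\mathrm{Argmin}_v\langle\nabla_xF_\lambda(x,z),v\rangle+h(v)$ (independent of the choice). Short stepsize at $(x,z,v^+,\lambda)$: it equals $0$ if $G_{z,\lambda}(x)=\|v^+-x\|=0$, and $\min\big\{1,\frac{G_{z,\lambda}(x)}{(L_\Psi(x,z)+L_f)\|v^+-x\|^2}\big\}$ otherwise. Algorithm: choose $(x^0,z^0)\in\mathrm{dom}\,h\times\mathbb{R}^m_+$, a positive increasing sequence $\{\lambda_k\}$ ($\lambda_{k+1}>\lambda_k>0$) with $\lambda_k\to\infty$, a positive summable sequence $\{\sigma_k\}$ with $\sigma_k\le\lambda_k$, and stepsizes $\alpha_k\in[0,1]$. For $k=0,1,2,\dots$: $v^k\in\mathrm{Argmin}_{v}\ \langle\nabla_xF_{\lambda_k}(x^k,z^k),v\rangle+h(v)$ (any minimizer); $x^{k+1}=x^k+\alpha_k(v^k-x^k)$; $z^{k+1}=z^k+\sigma_k\max\{-z^k/\lambda_k,\ g(x^{k+1})\}$.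 *)

theory Defs
  imports "HOL-Analysis.Analysis" "HOL-Library.Landau_Symbols"
begin

text \<open>The gradient of a real-valued function; only meaningful where the function is differentiable.\<close>

definition grad :: "('a::euclidean_space \<Rightarrow> real) \<Rightarrow> 'a \<Rightarrow> 'a" where
  "grad f x = (THE D. GDERIV f x :> D)"

text \<open>Extended-real-valued functions. Closedness and convexity are those of the epigraph.\<close>

definition effdom :: "('a \<Rightarrow> ereal) \<Rightarrow> 'a set" where
  "effdom h = {x. h x < \<infinity>}"

definition proper_fun :: "('a \<Rightarrow> ereal) \<Rightarrow> bool" where
  "proper_fun h \<longleftrightarrow> (\<forall>x. h x \<noteq> -\<infinity>) \<and> effdom h \<noteq> {}"

definition epi :: "('a \<Rightarrow> ereal) \<Rightarrow> ('a \<times> real) set" where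
  "epi h = {(x, t). h x \<le> ereal t}"

definition closed_fun :: "('a::euclidean_space \<Rightarrow> ereal) \<Rightarrow> bool" where
  "closed_fun h \<longleftrightarrow> closed (epi h)"

definition convex_fun :: "('a::euclidean_space \<Rightarrow> ereal) \<Rightarrow> bool" where
  "convex_fun h \<longleftrightarrow> convex (epi h)"

text \<open>For proper \<open>h\<close> the set below is empty outside the effective domain.\<close>

definition subdifferential :: "('a::euclidean_space \<Rightarrow> ereal) \<Rightarrow> 'a \<Rightarrow> 'a set" where
  "subdifferential h x = {s. \<forall>y. h x + ereal (s \<bullet> (y - x)) \<le> h y}"

definition lin_argmin :: "('a::euclidean_space \<Rightarrow> ereal) \<Rightarrow> 'a \<Rightarrow> 'a set" where
  "lin_argmin h u = {v. is_arg_min (\<lambda>v. ereal (u \<bullet> v) + h v) (\<lambda>_. True) v}"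

definition pos_part :: "real ^ 'm \<Rightarrow> real ^ 'm" where
  "pos_part y = (\<chi> i. max (y $ i) 0)"

text \<open>The program: minimize \<open>f + h\<close> subject to \<open>g \<le> 0\<close>, where the order on
  \<open>real ^ 'm\<close> is componentwise and \<open>\<lambda>x. g x $ i\<close> is the constraint with index \<open>i\<close>.\<close>

definition opt_value ::
  "('a::euclidean_space \<Rightarrow> real) \<Rightarrow> ('a \<Rightarrow> ereal) \<Rightarrow> ('a \<Rightarrow> real ^ 'm) \<Rightarrow> ereal" where
  "opt_value f h g = (INF x\<in>{x. g x \<le> 0}. ereal (f x) + h x)"

definition kkt_point ::
  "('a::euclidean_space \<Rightarrow> real) \<Rightarrow> ('a \<Rightarrow> ereal) \<Rightarrow> ('a \<Rightarrow> real ^ 'm) \<Rightarrow> 'a \<Rightarrow> real ^ 'm \<Rightarrow> bool" where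
  "kkt_point f h g x z \<longleftrightarrow>
     0 \<in> (\<lambda>s. grad f x + s + (\<Sum>i\<in>UNIV. z $ i *\<^sub>R grad (\<lambda>y. g y $ i) x)) ` subdifferential h x \<and>
     g x \<le> 0 \<and> 0 \<le> z \<and> z \<bullet> g x = 0"

definition slater :: "('a::euclidean_space \<Rightarrow> ereal) \<Rightarrow> ('a \<Rightarrow> real ^ 'm) \<Rightarrow> bool" where
  "slater h g \<longleftrightarrow> (\<exists>x\<in>effdom h. \<forall>i. g x $ i < 0)"

text \<open>The augmented Lagrangian.\<close>

definition Psi :: "('a::euclidean_space \<Rightarrow> real ^ 'm) \<Rightarrow> real \<Rightarrow> 'a \<Rightarrow> real ^ 'm \<Rightarrow> real" where
  "Psi g l x z = l / 2 * (\<Sum>i\<in>UNIV. (max (g x $ i + z $ i / l) 0)\<^sup>2 - (z $ i / l)\<^sup>2)"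

definition aug_F ::
  "('a::euclidean_space \<Rightarrow> real) \<Rightarrow> ('a \<Rightarrow> real ^ 'm) \<Rightarrow> real \<Rightarrow> 'a \<Rightarrow> real ^ 'm \<Rightarrow> real" where
  "aug_F f g l x z = f x + Psi g l x z"

definition grad_F ::
  "('a::euclidean_space \<Rightarrow> real) \<Rightarrow> ('a \<Rightarrow> real ^ 'm) \<Rightarrow> real \<Rightarrow> 'a \<Rightarrow> real ^ 'm \<Rightarrow> 'a" where
  "grad_F f g l x z = grad (\<lambda>y. aug_F f g l y z) x"

definition L_Psi ::
  "('m \<Rightarrow> real) \<Rightarrow> ('m \<Rightarrow> real) \<Rightarrow> ('a::euclidean_space \<Rightarrow> real ^ 'm) \<Rightarrow> real \<Rightarrow> 'a \<Rightarrow> real ^ 'm \<Rightarrow> real" where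
  "L_Psi B Lg g l x z = (\<Sum>i\<in>UNIV. l * (B i)\<^sup>2 + Lg i * max (l * g x $ i + z $ i) 0)"

definition aug_argmin ::
  "('a::euclidean_space \<Rightarrow> real) \<Rightarrow> ('a \<Rightarrow> ereal) \<Rightarrow> ('a \<Rightarrow> real ^ 'm) \<Rightarrow> real \<Rightarrow> 'a \<Rightarrow> real ^ 'm \<Rightarrow> 'a set" where
  "aug_argmin f h g l x z = lin_argmin h (grad_F f g l x z)"

text \<open>The value of the gap function does not depend on which minimizer is selected.\<close>

definition gap ::
  "('a::euclidean_space \<Rightarrow> real) \<Rightarrow> ('a \<Rightarrow> ereal) \<Rightarrow> ('a \<Rightarrow> real ^ 'm) \<Rightarrow> real \<Rightarrow> real ^ 'm \<Rightarrow> 'a \<Rightarrow> ereal" where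
  "gap f h g l z x =
     (let v = (SOME v. v \<in> aug_argmin f h g l x z)
      in ereal (grad_F f g l x z \<bullet> (x - v)) + h x - h v)"

definition short_step ::
  "('a::euclidean_space \<Rightarrow> real) \<Rightarrow> ('a \<Rightarrow> ereal) \<Rightarrow> ('a \<Rightarrow> real ^ 'm) \<Rightarrow>
   real \<Rightarrow> ('m \<Rightarrow> real) \<Rightarrow> ('m \<Rightarrow> real) \<Rightarrow> 'a \<Rightarrow> real ^ 'm \<Rightarrow> 'a \<Rightarrow> real \<Rightarrow> real" where
  "short_step f h g Lf Lg B x z v l =
     (if gap f h g l z x = 0 \<and> norm (v - x) = 0 then 0
      else real_of_ereal (min 1 (gap f h g l z x / ereal ((L_Psi B Lg g l x z + Lf) * (norm (v - x))\<^sup>2))))"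

text \<open>The sequences \<open>x\<close>, \<open>z\<close>, \<open>v\<close> are generated by the single-loop algorithm with parameters
  \<open>lam\<close>, \<open>sig\<close> and stepsizes \<open>alp\<close>.\<close>

definition single_loop ::
  "('a::euclidean_space \<Rightarrow> real) \<Rightarrow> ('a \<Rightarrow> ereal) \<Rightarrow> ('a \<Rightarrow> real ^ 'm) \<Rightarrow>
   (nat \<Rightarrow> real) \<Rightarrow> (nat \<Rightarrow> real) \<Rightarrow> (nat \<Rightarrow> real) \<Rightarrow>
   (nat \<Rightarrow> 'a) \<Rightarrow> (nat \<Rightarrow> real ^ 'm) \<Rightarrow> (nat \<Rightarrow> 'a) \<Rightarrow> bool" where
  "single_loop f h g lam sig alp x z v \<longleftrightarrow>
     x 0 \<in> effdom h \<and> 0 \<le> z 0 \<and>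
     (\<forall>k. 0 < lam k \<and> lam k < lam (Suc k)) \<and> filterlim lam at_top sequentially \<and>
     (\<forall>k. 0 < sig k \<and> sig k \<le> lam k) \<and> summable sig \<and>
     (\<forall>k. 0 \<le> alp k \<and> alp k \<le> 1) \<and>
     (\<forall>k. v k \<in> aug_argmin f h g (lam k) (x k) (z k) \<and>
          x (Suc k) = x k + alp k *\<^sub>R (v k - x k) \<and>
          z (Suc k) = z k + sig k *\<^sub>R (\<chi> i. max (- (z k $ i) / lam k) (g (x (Suc k)) $ i)))"

text \<open>The larger of the objective error and the constraint violation at a point.\<close>

definition err ::
  "('a::euclidean_space \<Rightarrow> real) \<Rightarrow> ('a \<Rightarrow> ereal) \<Rightarrow> ('a \<Rightarrow> real ^ 'm) \<Rightarrow> 'a \<Rightarrow> ereal" where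
  "err f h g x =
     max \<bar>ereal (f x) + h x - opt_value f h g\<bar> (ereal (norm (pos_part (g x))))"

definition seq_cluster_point :: "(nat \<Rightarrow> 'a::topological_space) \<Rightarrow> 'a \<Rightarrow> bool" where
  "seq_cluster_point X p \<longleftrightarrow> (\<exists>s. strict_mono s \<and> (X \<circ> s) \<longlonglongrightarrow> p)"

end

theory Submission
  imports Defs
begin

text \<open>The proof follows the excess \<open>a\<^sub>k\<close> of the augmented Lagrangian plus \<open>h\<close> at \<open>(x\<^sup>k, z\<^sup>k)\<close> over
  the optimal value. It is at most the gap \<open>G\<^sub>k\<close>, and by the KKT conditions at least
  \<open>\<lambda>\<^sub>k / 4 * \<parallel>[g(x\<^sup>k)]\<^sub>+\<parallel>\<^sup>2 - O(1 / \<lambda>\<^sub>k)\<close>. The short step decreases it by at least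
  \<open>min (G\<^sub>k / 2) (G\<^sub>k\<^sup>2 / (C k\<^sup>\<tau>))\<close>. The Lagrangian is concave in the penalty parameter and in the
  multiplier, so updating them costs at most a multiple of
  \<open>(\<sigma>\<^sub>k + \<lambda>\<^sub>k\<^sub>+\<^sub>1 - \<lambda>\<^sub>k) (\<parallel>[g(x\<^sup>k\<^sup>+\<^sup>1)]\<^sub>+\<parallel>\<^sup>2 + 1 / \<lambda>\<^sub>k\<^sup>2)\<close>, and the lower bound turns the violation back into
  excess: the cost is \<open>O(1 / k)\<close> times the excess plus \<open>O(k\<^sup>-\<^sup>1\<^sup>-\<^sup>\<tau>)\<close>. Induction on this recursion
  gives \<open>a\<^sub>k = O(k\<^sup>-\<^sup>s)\<close> with \<open>s = min \<tau> (1 - \<tau>)\<close>, which bounds the objective error and the violation;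
  the rate \<open>k\<^sup>-\<^sup>1\<^sup>/\<^sup>2\<close> is never the dominant one. Were the gaps bounded away from zero, the recursion
  would force \<open>a\<^sub>k\<close> to minus infinity, so they vanish along a subsequence, and stationarity passes to
  its cluster points.\<close>

subsection \<open>Gradients\<close>

lemma grad_eqI:
  assumes "GDERIV f x :> D"
  shows "grad f x = D"
  unfolding grad_def
proof (rule the_equality)
  show "GDERIV f x :> D" by fact
  fix E assume "GDERIV f x :> E"
  then have "(\<lambda>u. u \<bullet> E) = (\<lambda>u. u \<bullet> D)"
    using assms has_derivative_unique unfolding gderiv_def by blast
  then show "E = D"
    by (metis inner_commute vector_eq_rdot)
qed

lemma GDERIV_grad:
  fixes f :: "'a::euclidean_space \<Rightarrow> real"
  assumes "f differentiable (at x)"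
  shows "GDERIV f x :> grad f x"
proof -
  obtain f' where f': "(f has_derivative f') (at x)"
    using assms by (auto simp: differentiable_def)
  interpret f': bounded_linear f'
    using f' by (rule has_derivative_bounded_linear)
  define v where "v = (\<Sum>b\<in>Basis. f' b *\<^sub>R b)"
  have "f' u = u \<bullet> v" for u
  proof -
    have "f' u = f' (\<Sum>b\<in>Basis. (u \<bullet> b) *\<^sub>R b)"
      by (simp add: euclidean_representation)
    also have "\<dots> = (\<Sum>b\<in>Basis. (u \<bullet> b) * f' b)"
      by (simp add: f'.sum f'.scaleR)
    finally show ?thesis
      by (simp add: v_def inner_sum_right mult.commute)
  qed
  then have "f' = (\<lambda>u. u \<bullet> v)" by auto
  then have "GDERIV f x :> v"
    using f' by (simp add: gderiv_def)
  then show ?thesis by (simp add: grad_eqI)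
qed

lemma GDERIV_sum:
  assumes "\<And>i. i \<in> I \<Longrightarrow> GDERIV (f i) x :> D i"
  shows "GDERIV (\<lambda>x. \<Sum>i\<in>I. f i x) x :> (\<Sum>i\<in>I. D i)"
  using assms unfolding gderiv_def inner_sum_right by (intro has_derivative_sum)

lemma GDERIV_line:
  assumes "GDERIV f (a + t *\<^sub>R d) :> D"
  shows "((\<lambda>t. f (a + t *\<^sub>R d)) has_real_derivative d \<bullet> D) (at t)"
proof -
  have "((\<lambda>t. a + t *\<^sub>R d) has_derivative (\<lambda>s. s *\<^sub>R d)) (at t)"
    by (auto intro!: derivative_eq_intros)
  from diff_chain_at[OF this assms[unfolded gderiv_def]]
  show ?thesis
    by (simp add: has_field_derivative_def o_def mult_commute_abs)
qed

text \<open>Restricting \<open>f\<close> to the line through \<open>a\<close> and \<open>y\<close>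
  reduces this to the tangent inequality for scalar convex functions.\<close>

lemma convex_above_tangent:
  fixes f :: "'a::euclidean_space \<Rightarrow> real"
  assumes cv: "convex_on UNIV f" and df: "f differentiable (at a)"
  shows "f a + grad f a \<bullet> (y - a) \<le> f y"
proof -
  let ?\<phi> = "\<lambda>t. f (a + t *\<^sub>R (y - a))"
  have "convex_on UNIV ?\<phi>"
  proof (rule convex_onI)
    fix t s r :: real assume "0 < t" "t < 1"
    have "a + ((1 - t) *\<^sub>R s + t *\<^sub>R r) *\<^sub>R (y - a)
        = (1 - t) *\<^sub>R (a + s *\<^sub>R (y - a)) + t *\<^sub>R (a + r *\<^sub>R (y - a))"
      by (simp add: algebra_simps)
    then show "?\<phi> ((1 - t) *\<^sub>R s + t *\<^sub>R r) \<le> (1 - t) * ?\<phi> s + t * ?\<phi> r"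
      using convex_onD[OF cv, of t] \<open>0 < t\<close> \<open>t < 1\<close> by auto
  qed simp
  moreover have "(?\<phi> has_real_derivative (y - a) \<bullet> grad f a) (at 0 within UNIV)"
    using GDERIV_line[of f a 0 "y - a" "grad f a"] GDERIV_grad[OF df] by simp
  ultimately have "(y - a) \<bullet> grad f a * (1 - 0) \<le> ?\<phi> 1 - ?\<phi> 0"
    by (intro convex_on_imp_above_tangent[where A = UNIV]) auto
  then show ?thesis by (simp add: inner_commute)
qed

text \<open>The descent lemma. The Lipschitz condition is used along the segment only, which stays
  in the convex set \<open>S\<close>; this matters for constraints whose gradients are controlled on
  the domain of \<open>h\<close> alone.\<close>

lemma lipschitz_grad_quadratic_bound:
  fixes f :: "'a::euclidean_space \<Rightarrow> real"
  assumes df: "\<And>y. f differentiable (at y)" and lip: "L-lipschitz_on S (grad f)"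
    and S: "convex S" "a \<in> S" "b \<in> S"
  shows "f b \<le> f a + grad f a \<bullet> (b - a) + L / 2 * (norm (b - a))\<^sup>2"
proof -
  define d where "d = b - a"
  \<comment> \<open>This is \<open>f\<close> along the segment minus its quadratic model;
    Cauchy-Schwarz and the Lipschitz condition make its derivative nonpositive.\<close>
  define \<phi> where "\<phi> t = f (a + t *\<^sub>R d) - t * (grad f a \<bullet> d) - L / 2 * t\<^sup>2 * (norm d)\<^sup>2" for t
  have "\<phi> 1 \<le> \<phi> 0"
  proof (rule DERIV_nonpos_imp_nonincreasing[where f = \<phi>])
    show "(0::real) \<le> 1" by simp
    fix t :: real assume t: "0 \<le> t" "t \<le> 1"
    let ?y = "a + t *\<^sub>R d"
    have "?y = (1 - t) *\<^sub>R a + t *\<^sub>R b" by (simp add: d_def algebra_simps)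
    then have y: "?y \<in> S" using S t by (simp add: convex_alt)
    have "(\<phi> has_real_derivative d \<bullet> grad f ?y - grad f a \<bullet> d - L * t * (norm d)\<^sup>2) (at t)"
      unfolding \<phi>_def by (auto intro!: derivative_eq_intros GDERIV_line GDERIV_grad df)
    moreover have "d \<bullet> grad f ?y - grad f a \<bullet> d = (grad f ?y - grad f a) \<bullet> d"
      by (simp add: inner_diff_right inner_commute)
    moreover have "(grad f ?y - grad f a) \<bullet> d \<le> L * t * (norm d)\<^sup>2"
    proof -
      have "norm (grad f ?y - grad f a) \<le> L * norm (t *\<^sub>R d)"
        using lipschitz_onD[OF lip y S(2)] by (simp add: dist_norm)
      then have "norm (grad f ?y - grad f a) * norm d \<le> (L * norm (t *\<^sub>R d)) * norm d"
        by (rule mult_right_mono) simp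
      then show ?thesis
        using norm_cauchy_schwarz[of "grad f ?y - grad f a" d] t
        by (simp add: power2_eq_square mult.assoc)
    qed
    ultimately show "\<exists>y. (\<phi> has_real_derivative y) (at t) \<and> y \<le> 0" by force
  qed
  then show ?thesis by (simp add: \<phi>_def d_def)
qed

subsection \<open>The augmented Lagrangian term of a single constraint\<close>

text \<open>The squared positive part has the 2-Lipschitz derivative \<open>2 * max t 0\<close>, so
  its first-order Taylor remainder is at most the squared increment. The bound yields both
  differentiability at the kink and the curvature of the penalty.\<close>

lemma sq_max0_quadratic_bound:
  fixes s t :: real
  shows "\<bar>(max s 0)\<^sup>2 - (max t 0)\<^sup>2 - 2 * max t 0 * (s - t)\<bar> \<le> (s - t)\<^sup>2"
proof (cases "0 \<le> s"; cases "0 \<le> t")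
  assume "0 \<le> s" "0 \<le> t"
  moreover have "s\<^sup>2 - t\<^sup>2 - 2 * t * (s - t) = (s - t)\<^sup>2"
    by (simp add: power2_eq_square algebra_simps)
  ultimately show ?thesis by simp
next
  assume st: "0 \<le> s" "\<not> 0 \<le> t"
  then have "s\<^sup>2 \<le> (s - t)\<^sup>2" by (intro power_mono) auto
  then show ?thesis using st by simp
next
  assume st: "\<not> 0 \<le> s" "0 \<le> t"
  then have "t\<^sup>2 - 2 * t * s \<le> (s - t)\<^sup>2" "t * s \<le> 0"
    by (auto simp: power2_eq_square algebra_simps mult_nonpos_nonneg)
  moreover have "0 \<le> t\<^sup>2" by simp
  ultimately have "\<bar>t\<^sup>2 - 2 * t * s\<bar> \<le> (s - t)\<^sup>2" by linarith
  then show ?thesis using st by (simp add: power2_eq_square algebra_simps)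
qed auto

lemma DERIV_sq_max0: "((\<lambda>t. (max t 0)\<^sup>2) has_real_derivative 2 * max t 0) (at t)"
  unfolding DERIV_def
proof (rule LIM_zero_cancel, rule Lim_null_comparison)
  show "\<forall>\<^sub>F h in at 0. norm (((max (t + h) 0)\<^sup>2 - (max t 0)\<^sup>2) / h - 2 * max t 0) \<le> \<bar>h\<bar>"
    unfolding eventually_at_filter
  proof (rule always_eventually, safe)
    fix h :: real assume "h \<noteq> 0"
    then have "((max (t + h) 0)\<^sup>2 - (max t 0)\<^sup>2) / h - 2 * max t 0
        = ((max (t + h) 0)\<^sup>2 - (max t 0)\<^sup>2 - 2 * max t 0 * h) / h"
      by (simp add: field_simps)
    moreover have "\<bar>\<dots>\<bar> \<le> h\<^sup>2 / \<bar>h\<bar>"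
      using sq_max0_quadratic_bound[of "t + h" t] by (simp add: divide_right_mono)
    moreover have "h\<^sup>2 / \<bar>h\<bar> = \<bar>h\<bar>"
      using \<open>h \<noteq> 0\<close> by (cases "h > 0") (auto simp: power2_eq_square)
    ultimately show "norm (((max (t + h) 0)\<^sup>2 - (max t 0)\<^sup>2) / h - 2 * max t 0) \<le> \<bar>h\<bar>"
      by simp
  qed
  show "((\<lambda>h. \<bar>h\<bar>) \<longlongrightarrow> 0) (at (0::real))"
    by (auto intro!: tendsto_eq_intros)
qed

text \<open>One summand of \<open>Psi\<close>, with constraint value \<open>a\<close> and multiplier
  \<open>z\<close>, rescaled so that the updated multiplier \<open>max (l * a + z) 0\<close>
  appears.\<close>

definition penalty :: "real \<Rightarrow> real \<Rightarrow> real \<Rightarrow> real" where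
  "penalty l a z = ((max (l * a + z) 0)\<^sup>2 - z\<^sup>2) / (2 * l)"

lemma Psi_penalty:
  assumes "l > 0"
  shows "Psi g l x z = (\<Sum>i\<in>UNIV. penalty l (g x $ i) (z $ i))"
proof -
  have "l / 2 * ((max (a + b / l) 0)\<^sup>2 - (b / l)\<^sup>2) = penalty l a b" for a b
  proof -
    have *: "l * max (a + b / l) 0 = max (l * a + b) 0"
      using assms by (simp add: max_mult_distrib_left distrib_left)
    have "penalty l a b = ((l * max (a + b / l) 0)\<^sup>2 - (l * (b / l))\<^sup>2) / (2 * l)"
      using assms by (simp add: penalty_def *)
    also have "\<dots> = l / 2 * ((max (a + b / l) 0)\<^sup>2 - (b / l)\<^sup>2)"
      using assms by (simp add: field_simps power2_eq_square)
    finally show ?thesis ..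
  qed
  then show ?thesis by (simp add: Psi_def sum_distrib_left)
qed

lemma penalty_nonpos:
  assumes "l > 0" "a \<le> 0" "z \<ge> 0"
  shows "penalty l a z \<le> 0"
proof -
  have "max (l * a + z) 0 \<le> z"
    using assms by (auto simp: mult_nonneg_nonpos)
  then have "(max (l * a + z) 0)\<^sup>2 \<le> z\<^sup>2"
    by (intro power_mono) auto
  then show ?thesis using assms by (simp add: penalty_def divide_nonpos_pos)
qed

text \<open>The penalty is the maximum over \<open>w \<ge> 0\<close> of the left-hand side, attained
  at \<open>max (l * a + z) 0\<close>; this half of the dual representation follows by completing
  the square.\<close>

lemma penalty_ge_linear:
  assumes "l > 0" "w \<ge> 0"
  shows "w * a - (w - z)\<^sup>2 / (2 * l) \<le> penalty l a z"
proof -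
  define m where "m = max (l * a + z) 0"
  have "m * w \<ge> (l * a + z) * w" using assms by (intro mult_right_mono) (auto simp: m_def)
  moreover have "0 \<le> (m - w)\<^sup>2" by simp
  ultimately have "2 * l * w * a - (w - z)\<^sup>2 \<le> m\<^sup>2 - z\<^sup>2"
    by (simp add: power2_eq_square algebra_simps)
  then have "(2 * l * w * a - (w - z)\<^sup>2) / (2 * l) \<le> penalty l a z"
    using assms by (simp add: penalty_def m_def divide_right_mono)
  then show ?thesis using assms by (simp add: diff_divide_distrib)
qed

text \<open>The dual maximizer at \<open>a\<close> gives equality there, and its affine function of
  the constraint value stays below the penalty at every \<open>b\<close>.\<close>

lemma penalty_tangent:
  assumes l: "l > 0"
  shows "penalty l a z + max (l * a + z) 0 * (b - a) \<le> penalty l b z"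
proof -
  define m where "m = max (l * a + z) 0"
  have m: "m \<ge> 0" "m * (l * a + z) = m\<^sup>2"
    by (auto simp: m_def max_def power2_eq_square)
  have "m * a - (m - z)\<^sup>2 / (2 * l) = (2 * (m * (l * a + z)) - m\<^sup>2 - z\<^sup>2) / (2 * l)"
    using l by (simp add: field_simps power2_eq_square)
  also have "\<dots> = penalty l a z"
    unfolding m(2) by (simp add: penalty_def m_def)
  finally show ?thesis
    using penalty_ge_linear[OF l m(1), of b z] by (simp add: m_def algebra_simps)
qed

text \<open>For \<open>a \<ge> 0\<close>, half of the quadratic term
  \<open>l / 2 * a\<^sup>2\<close> absorbs \<open>w * a\<close> by completing the square and the
  other half remains. For \<open>a < 0\<close> the dual lower bound suffices.\<close>

lemma penalty_ge_quadratic: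
  assumes l: "l > 0" and "w \<ge> 0" "z \<ge> 0"
  shows "l / 4 * (max a 0)\<^sup>2 - (w\<^sup>2 + z\<^sup>2) / l \<le> penalty l a z - w * a"
proof (cases "a \<ge> 0")
  case True
  then have "max (l * a + z) 0 = l * a + z" using assms by simp
  then have p: "penalty l a z = l / 2 * a\<^sup>2 + a * z"
    using l by (simp add: penalty_def field_simps power2_eq_square)
  have "0 \<le> (l * a / 2 - w)\<^sup>2 / l" using l by simp
  also have "\<dots> = l / 4 * a\<^sup>2 - w * a + w\<^sup>2 / l"
    using l by (simp add: field_simps power2_eq_square)
  finally have "l / 4 * a\<^sup>2 - w\<^sup>2 / l \<le> l / 2 * a\<^sup>2 - w * a" by simp
  moreover have "0 \<le> a * z" "0 \<le> z\<^sup>2 / l" using assms True by auto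
  ultimately show ?thesis using True by (simp add: p add_divide_distrib)
next
  case False
  have "(w - z)\<^sup>2 \<le> 2 * (w\<^sup>2 + z\<^sup>2)"
    using sum_squares_ge_zero[of "w + z" 0] by (simp add: power2_eq_square algebra_simps)
  then have "(w - z)\<^sup>2 / (2 * l) \<le> (w\<^sup>2 + z\<^sup>2) / l"
    using l by (simp add: field_simps)
  then show ?thesis using penalty_ge_linear[of l w a z] assms False by simp
qed

lemma penalty_quadratic_bound:
  assumes l: "l > 0"
  shows "penalty l b z \<le> penalty l a z + max (l * a + z) 0 * (b - a) + l / 2 * (b - a)\<^sup>2"
proof -
  have "(max (l * b + z) 0)\<^sup>2 \<le> (max (l * a + z) 0)\<^sup>2 + 2 * max (l * a + z) 0 * (l * (b - a)) + (l * (b - a))\<^sup>2"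
    using sq_max0_quadratic_bound[of "l * b + z" "l * a + z"] by (simp add: algebra_simps abs_le_iff)
  then have "penalty l b z \<le> ((max (l * a + z) 0)\<^sup>2 + 2 * max (l * a + z) 0 * (l * (b - a))
      + (l * (b - a))\<^sup>2 - z\<^sup>2) / (2 * l)"
    using l unfolding penalty_def by (intro divide_right_mono) auto
  also have "\<dots> = penalty l a z + max (l * a + z) 0 * (b - a) + l / 2 * (b - a)\<^sup>2"
    using l by (simp add: penalty_def field_simps power2_eq_square)
  finally show ?thesis .
qed

text \<open>The number \<open>max a (- z / l)\<close> is the derivative of the penalty in the
  multiplier. Splitting its square separates the constraint violation from a term that vanishes as
  \<open>l\<close> grows.\<close>

lemma sq_max_le:
  fixes a z l :: real
  assumes "l > 0" "z \<ge> 0"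
  shows "(max a (- z / l))\<^sup>2 \<le> (max a 0)\<^sup>2 + (z / l)\<^sup>2"
proof (cases "a \<ge> 0")
  case True
  moreover have "- z / l \<le> 0" using assms by (simp add: divide_nonpos_pos)
  ultimately show ?thesis by (simp add: max_def)
next
  case False
  have "\<bar>max a (- z / l)\<bar> \<le> z / l" using False assms by (auto simp: max_def)
  then have "(max a (- z / l))\<^sup>2 \<le> (z / l)\<^sup>2"
    by (metis abs_ge_zero power2_abs power_mono)
  then show ?thesis by (simp add: add_increasing)
qed

text \<open>The penalty is concave in the parameter, with derivative \<open>(max a (- z / l))\<^sup>2 / 2\<close>.\<close>

lemma penalty_param_bound:
  assumes l: "0 < l" "l \<le> l'" and z: "z \<ge> 0"
  shows "penalty l' a z \<le> penalty l a z + (l' - l) / 2 * (max a (- z / l))\<^sup>2"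
proof (cases "l * a + z \<ge> 0")
  case True
  \<comment> \<open>Here the penalty for \<open>l\<close> equals
    \<open>l / 2 * a\<^sup>2 + a * z\<close>, which is affine in \<open>l\<close>; for
    \<open>l'\<close> the same expression is an upper bound even if the positive part is
    clipped.\<close>
  then have a: "max a (- z / l) = a" "max (l * a + z) 0 = l * a + z"
    using l by (auto simp: field_simps max_def)
  have "(max (l' * a + z) 0)\<^sup>2 \<le> (l' * a + z)\<^sup>2" by (simp add: max_def)
  then have "penalty l' a z \<le> ((l' * a + z)\<^sup>2 - z\<^sup>2) / (2 * l')"
    using l unfolding penalty_def by (intro divide_right_mono) auto
  also have "\<dots> = l' / 2 * a\<^sup>2 + a * z"
    using l by (simp add: field_simps power2_eq_square)
  also have "l / 2 * a\<^sup>2 + a * z = penalty l a z"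
    using l unfolding penalty_def a(2) by (simp add: field_simps power2_eq_square)
  then have "l' / 2 * a\<^sup>2 + a * z = penalty l a z + (l' - l) / 2 * a\<^sup>2"
    by (simp add: left_diff_distrib diff_divide_distrib)
  finally show ?thesis unfolding a(1) .
next
  case False
  \<comment> \<open>Both positive parts are clipped, so the penalties are
    \<open>- z\<^sup>2 / (2 * l)\<close> and \<open>- z\<^sup>2 / (2 * l')\<close>.\<close>
  then have "a \<le> 0" using l z by (metis add_nonneg_nonneg linorder_not_le mult_pos_pos less_imp_le)
  then have "l' * a \<le> l * a" using l by (intro mult_right_mono_neg) auto
  then have m: "max (l * a + z) 0 = 0" "max (l' * a + z) 0 = 0" "max a (- z / l) = - z / l"
    using False l by (auto simp: max_def field_simps)
  have "(l' - l) / 2 * z\<^sup>2 / (l * l') \<le> (l' - l) / 2 * z\<^sup>2 / (l * l)"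
    using l by (intro divide_left_mono mult_left_mono) auto
  moreover have "- z\<^sup>2 / (2 * l') + z\<^sup>2 / (2 * l) = (l' - l) / 2 * z\<^sup>2 / (l * l')"
    using l by (simp add: field_simps)
  ultimately show ?thesis
    using l unfolding penalty_def m by (simp add: power2_eq_square)
qed

text \<open>Concavity in the multiplier: the step below is taken along the derivative.\<close>

lemma penalty_multiplier_bound:
  assumes l: "0 < l"
  shows "penalty l a (z + s * max (- z / l) a) \<le> penalty l a z + s * (max a (- z / l))\<^sup>2"
proof -
  define d where "d = s * max (- z / l) a"
  define m where "m = max (l * a + z) 0"
  \<comment> \<open>Thus \<open>(m - z) / l\<close> is the direction of the multiplier step.\<close>
  have m: "m = l * max a (- z / l) + z"
    using l by (cases "l * a + z \<ge> 0") (auto simp: m_def max_def field_simps)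
  have "(max (l * a + (z + d)) 0)\<^sup>2 \<le> m\<^sup>2 + 2 * m * d + d\<^sup>2"
    using sq_max0_quadratic_bound[of "l * a + (z + d)" "l * a + z"]
    by (simp add: algebra_simps abs_le_iff m_def)
  then have "penalty l a (z + d) \<le> (m\<^sup>2 + 2 * m * d + d\<^sup>2 - (z + d)\<^sup>2) / (2 * l)"
    using l unfolding penalty_def by (intro divide_right_mono) auto
  \<comment> \<open>The two \<open>d\<^sup>2\<close> terms cancel and only the first-order term in
    \<open>d\<close> survives.\<close>
  also have "\<dots> = penalty l a z + (m - z) / l * d"
    using l unfolding penalty_def m_def[symmetric] by (simp add: field_simps power2_eq_square)
  also have "(m - z) / l * d = s * (max a (- z / l))\<^sup>2"
    using l by (simp add: m d_def power2_eq_square max.commute)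
  finally show ?thesis by (simp add: d_def)
qed

subsection \<open>Sequences with a sublinear decrease\<close>

text \<open>From one index to the next, a power with exponent in \<open>[-1, 0]\<close> shrinks by
  no more than the factor \<open>1 - 1 / k\<close>. This is the room available in the induction for
  the rate.\<close>

lemma powr_neg_Suc_ge:
  assumes s: "0 \<le> s" "s \<le> 1" and k: "k \<ge> (1::nat)"
  shows "real k powr (- s) * (1 - 1 / real k) \<le> real (Suc k) powr (- s)"
proof -
  have "1 - 1 / real k \<le> 1 / (1 + 1 / real k)"
    using k by (simp add: field_simps)
  also have "\<dots> = (1 + 1 / real k) powr (- 1)"
    using k by (simp add: powr_minus_divide add_pos_nonneg)
  also have "\<dots> \<le> (1 + 1 / real k) powr (- s)"
    using s by (intro powr_mono) auto
  finally have "real k powr (- s) * (1 - 1 / real k) \<le> real k powr (- s) * (1 + 1 / real k) powr (- s)"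
    by (intro mult_left_mono) auto
  also have "\<dots> = (real k * (1 + 1 / real k)) powr (- s)"
    by (rule powr_mult[symmetric])
  also have "real k * (1 + 1 / real k) = real (Suc k)"
    using k by (simp add: field_simps)
  finally show ?thesis .
qed

text \<open>The map sending \<open>t\<close> to \<open>max (t / 2) (t - t\<^sup>2 / L)\<close> is
  nondecreasing, because the parabola is the larger branch only up to its vertex
  \<open>L / 2\<close>. Hence an upper bound on \<open>a\<close> survives one decrease step.\<close>

lemma sub_min_mono:
  fixes a b G L :: real
  assumes "a \<le> b" "a \<le> G" "0 \<le> G" "0 \<le> b" "0 < L"
  shows "a - min (G / 2) (G\<^sup>2 / L) \<le> max (b / 2) (b - b\<^sup>2 / L)"
proof (cases "a \<le> 0")
  case True
  have "0 \<le> min (G / 2) (G\<^sup>2 / L)" using assms by simp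
  then show ?thesis using True assms by linarith
next
  case False
  then have "a\<^sup>2 / L \<le> G\<^sup>2 / L"
    using assms by (intro divide_right_mono power_mono) auto
  then have "a - min (G / 2) (G\<^sup>2 / L) \<le> max (a / 2) (a - a\<^sup>2 / L)"
    using assms by linarith
  moreover have "a - a\<^sup>2 / L \<le> max (b / 2) (b - b\<^sup>2 / L)"
  proof (cases "b \<le> L / 2")
    case True
    \<comment> \<open>Left of the vertex, \<open>a + b \<le> 2 * b \<le> L\<close>, so both factors
      are nonnegative.\<close>
    have "0 \<le> (b - a) * (1 - (a + b) / L)"
      using assms True by (intro mult_nonneg_nonneg) auto
    also have "\<dots> = (b - b\<^sup>2 / L) - (a - a\<^sup>2 / L)"
      by (simp add: algebra_simps power2_eq_square diff_divide_distrib add_divide_distrib)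
    finally show ?thesis by simp
  next
    case bL: False
    \<comment> \<open>The parabola never exceeds its vertex value \<open>L / 4\<close>, which lies
      below \<open>b / 2\<close> here.\<close>
    have "0 \<le> (a - L / 2)\<^sup>2 / L" using assms by simp
    also have "\<dots> = L / 4 - (a - a\<^sup>2 / L)"
      using assms by (simp add: field_simps power2_eq_square)
    finally have "a - a\<^sup>2 / L \<le> b / 2" using bL by linarith
    then show ?thesis by (rule max.coboundedI1)
  qed
  ultimately show ?thesis using assms by linarith
qed

text \<open>Abstract form of one iteration, with excess \<open>a\<close>, gap \<open>G\<close> and
  relative growth \<open>p\<close> caused by the parameter updates. The decrease is expressed by
  \<open>G\<close> because \<open>a\<close> may be negative. A single constant \<open>C\<close>
  bounds the growth, the curvature and the additive error.\<close>

locale sublinear_recursion =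
  fixes a G p :: "nat \<Rightarrow> real" and C \<tau> :: real and k0 :: nat
  assumes C: "C > 0" and tau: "0 < \<tau>" "\<tau> < 1"
    and gap_ge: "k \<ge> k0 \<Longrightarrow> a k \<le> G k" and gap_nonneg: "k \<ge> k0 \<Longrightarrow> 0 \<le> G k"
    and p: "k \<ge> k0 \<Longrightarrow> 0 \<le> p k" "k \<ge> k0 \<Longrightarrow> p k \<le> C / real k"
    and step: "k \<ge> k0 \<Longrightarrow> a (Suc k) \<le>
        (1 + p k) * (a k - min (G k / 2) ((G k)\<^sup>2 / (C * real k powr \<tau>))) + C * real k powr (- 1 - \<tau>)"
begin

text \<open>Induction with target \<open>b = K * k powr (- s)\<close>. The decrease
  \<open>b\<^sup>2 / L\<close> is quadratic in \<open>K\<close> and, by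
  \<open>s \<le> 1 - \<tau>\<close>, at least of order \<open>k powr (- s - 1)\<close>. Growth,
  error and the drop of the target have this order too, by \<open>s \<le> \<tau>\<close>, but are at
  most linear in \<open>K\<close>, so a large \<open>K\<close> wins.\<close>

lemma rate:
  assumes s: "0 \<le> s" "s \<le> \<tau>" "s \<le> 1 - \<tau>"
  obtains K N where "K > 0" "\<And>k. k \<ge> N \<Longrightarrow> a k \<le> K * real k powr (- s)"
proof -
  \<comment> \<open>Beyond this index \<open>1 / k\<close> and \<open>C / k\<close> are at most
    \<open>1 / 8\<close>, as the halving branch requires.\<close>
  define N where "N = max k0 (max 8 (nat \<lceil>8 * C\<rceil>))"
  \<comment> \<open>The three lower bounds serve, in turn, the absorption of the error, the
    quadratic branch and the base case.\<close>
  define K where "K = max 1 (max (C * (2 * C + 1)) (a N * real N powr s))"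
  have K: "K \<ge> 1" "K \<ge> C * (2 * C + 1)" "K \<ge> a N * real N powr s"
    by (auto simp: K_def)
  have bound: "a k \<le> K * real k powr (- s)" if "k \<ge> N" for k
    using that
  proof (induction k rule: dec_induct)
    case base
    have "N > 0" by (simp add: N_def)
    then show ?case using K(3) by (simp add: powr_minus_divide pos_le_divide_eq)
  next
    case (step k)
    define b where "b = K * real k powr (- s)"
    define L where "L = C * real k powr \<tau>"
    define V where "V = max (b / 2) (b - b\<^sup>2 / L)"
    \<comment> \<open>All terms of order \<open>k powr (- s - 1)\<close> are compared in units of
      \<open>q\<close>.\<close>
    define q where "q = real k powr (- s) / real k"
    define e where "e = C * real k powr (- 1 - \<tau>)"
    have k: "k \<ge> k0" "real k \<ge> 8" "real k \<ge> 8 * C" "k \<ge> 1"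
      using step.hyps by (auto simp: N_def)
    have b: "b > 0" using K k by (simp add: b_def)
    have L: "L > 0" using C k by (simp add: L_def)
    have q: "q > 0" using k by (simp add: q_def)
    have V: "V > 0" using b by (simp add: V_def less_max_iff_disj)
    have "a k - min (G k / 2) ((G k)\<^sup>2 / L) \<le> V"
      unfolding V_def
      using step.IH gap_ge[OF k(1)] gap_nonneg[OF k(1)] b L by (intro sub_min_mono) (auto simp: b_def)
    then have "(1 + p k) * (a k - min (G k / 2) ((G k)\<^sup>2 / L)) \<le> (1 + p k) * V"
      using p(1)[OF k(1)] by (intro mult_left_mono) auto
    also have "\<dots> \<le> (1 + C / k) * V"
      using p(2)[OF k(1)] V by (intro mult_right_mono) auto
    finally have a: "a (Suc k) \<le> (1 + C / k) * V + e"
      using sublinear_recursion.step[OF sublinear_recursion_axioms k(1)] by (simp add: L_def e_def)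
    have q1: "real k powr (- 1 - \<tau>) \<le> q"
    proof -
      have "real k powr (- 1 - \<tau>) \<le> real k powr (- s - 1)"
        using k s by (intro powr_mono) auto
      also have "\<dots> = q" using k by (simp add: q_def powr_diff)
      finally show ?thesis .
    qed
    have q2: "q \<le> real k powr (- 2 * s - \<tau>)"
    proof -
      have "real k powr (- s - 1) \<le> real k powr (- 2 * s - \<tau>)"
        using k s by (intro powr_mono) auto
      then show ?thesis using k by (simp add: q_def powr_diff)
    qed
    have e: "e \<le> C * q" using q1 C by (simp add: e_def)
    have bk: "b / k = K * q" by (simp add: b_def q_def)
    have "(1 + C / k) * V + e \<le> b * (1 - 1 / k)"
    proof (cases "V = b / 2")
      case True
      \<comment> \<open>Growth, error and the drop of the target cost at most \<open>b / 16\<close>,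
        \<open>b / 8\<close> and \<open>b / 8\<close>, which fit into the half of \<open>b\<close>
        that is freed.\<close>
      have "C / k \<le> 1 / 8" "1 / k \<le> 1 / 8" using k by (auto simp: field_simps)
      then have "C / k * (b / 2) \<le> 1 / 8 * (b / 2)" "1 / k * b \<le> 1 / 8 * b"
        "C / k * real k powr (- s) \<le> 1 / 8 * real k powr (- s)"
        using b by (simp_all only: mult_right_mono powr_ge_zero less_imp_le half_gt_zero)
      moreover have "C * q = C / k * real k powr (- s)" by (simp add: q_def)
      moreover have "real k powr (- s) \<le> b"
        using K mult_right_mono[of 1 K "real k powr (- s)"] by (simp add: b_def)
      moreover have "(1 + C / k) * V = b / 2 + C / k * (b / 2)" "b * (1 - 1 / k) = b - 1 / k * b"
        unfolding True by (simp_all add: algebra_simps)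
      ultimately show ?thesis using e b by linarith
    next
      case False
      then have V_eq: "V = b - b\<^sup>2 / L" by (auto simp: V_def max_def split: if_splits)
      have "real k powr (- 2 * s - \<tau>) = (real k powr (- s))\<^sup>2 / real k powr \<tau>"
        using k by (simp add: powr_diff power2_eq_square flip: powr_add)
      then have "b\<^sup>2 / L = K\<^sup>2 / C * real k powr (- 2 * s - \<tau>)"
        by (simp add: b_def L_def power_mult_distrib)
      also have "\<dots> \<ge> K\<^sup>2 / C * q"
        using C q2 by (intro mult_left_mono) auto
      finally have 1: "K\<^sup>2 / C * q \<le> b\<^sup>2 / L" .
      \<comment> \<open>The summands are the coefficients of \<open>q\<close> in the growth, the
        error and the drop of the target; the decrease contributes at least
        \<open>K\<^sup>2 / C\<close>.\<close>
      have "K * C + C + K \<le> K * (2 * C + 1)"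
        using K C by (simp add: algebra_simps)
      then have "(K * C + C + K) * C \<le> K * (2 * C + 1) * C"
        using C by (intro mult_right_mono) auto
      also have "\<dots> = K * (C * (2 * C + 1))" by (simp only: mult_ac)
      also have "\<dots> \<le> K\<^sup>2"
        unfolding power2_eq_square using K by (intro mult_left_mono) auto
      finally have "(K * C + C + K) * C \<le> K\<^sup>2" .
      then have "K * C + C + K \<le> K\<^sup>2 / C"
        using C by (simp add: pos_le_divide_eq)
      then have 2: "(K * C + C + K) * q \<le> K\<^sup>2 / C * q"
        using q by (intro mult_right_mono) auto
      have "C / k * (b\<^sup>2 / L) \<ge> 0" using C L by simp
      moreover have "(1 + C / k) * (b - t) = b + C * (b / k) - t - C / k * t" for t
        by (simp add: algebra_simps diff_divide_distrib)
      from this[of "b\<^sup>2 / L"] calculation have "(1 + C / k) * V \<le> b + C * (b / k) - b\<^sup>2 / L"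
        unfolding V_eq by linarith
      moreover have "b * (1 - 1 / k) = b - b / k" by (simp add: algebra_simps)
      ultimately show ?thesis using 1 2 e unfolding bk by (simp add: algebra_simps)
    qed
    also have "b * (1 - 1 / k) \<le> K * real (Suc k) powr (- s)"
      using powr_neg_Suc_ge[of s k] s tau k K by (simp add: b_def mult.assoc)
    finally show ?case using a by linarith
  qed
  show thesis by (rule that[of K N]) (use K bound in auto)
qed

text \<open>If the gaps stayed above \<epsilon>, each decrease would be at least a multiple of
  \<open>k powr (- \<tau>)\<close>. As \<open>\<tau> < 1\<close>, this beats the growth and error
  terms of order \<open>1 / k\<close>, and the net decrease, at least a multiple of
  \<open>1 / k\<close>, has divergent sum, against the lower bound \<open>M\<close>.\<close>

lemma gap_frequently_small:
  assumes lower: "\<And>k. k \<ge> k0 \<Longrightarrow> M \<le> a k" and "\<epsilon> > 0"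
  shows "\<exists>\<^sub>F k in sequentially. G k < \<epsilon>"
proof (rule ccontr)
  assume "\<not> (\<exists>\<^sub>F k in sequentially. G k < \<epsilon>)"
  then have "eventually (\<lambda>k. \<epsilon> \<le> G k) sequentially"
    by (simp add: frequently_def not_less)
  then obtain N1 where N1: "\<And>k. k \<ge> N1 \<Longrightarrow> \<epsilon> \<le> G k"
    by (auto simp: eventually_sequentially)
  \<comment> \<open>With exponent 0 the rate is an eventual upper bound on \<open>a\<close>, which
    controls the growth term.\<close>
  obtain K N2 where K: "K > 0" "\<And>k. k \<ge> N2 \<Longrightarrow> a k \<le> K * real k powr (- 0)"
    using rate[of 0] tau by auto
  define c where "c = min (\<epsilon> / 2) (\<epsilon>\<^sup>2 / C)"
  have c: "c > 0" using C \<open>\<epsilon> > 0\<close> by (simp add: c_def)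
  have "(\<lambda>k. real k powr (\<tau> - 1)) \<longlonglongrightarrow> 0"
    using tau by (intro tendsto_neg_powr filterlim_real_sequentially) auto
  \<comment> \<open>Since \<open>1 / k\<close> is \<open>k powr (\<tau> - 1)\<close> times
    \<open>k powr (- \<tau>)\<close>, this threshold makes growth and error cost at most half of the
    decrease.\<close>
  then have "eventually (\<lambda>k. real k powr (\<tau> - 1) < c / (2 * (C * K + C))) sequentially"
    by (rule order_tendstoD) (use c C K in \<open>auto intro!: divide_pos_pos add_pos_pos mult_pos_pos\<close>)
  then obtain N3 where N3: "\<And>k. k \<ge> N3 \<Longrightarrow> real k powr (\<tau> - 1) < c / (2 * (C * K + C))"
    by (auto simp: eventually_sequentially)
  define N where "N = max (max k0 1) (max N1 (max N2 N3))"
  have dec: "a (Suc k) \<le> a k - c / 2 * (1 / k)" if "k \<ge> N" for k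
  proof -
    define d where "d = min (G k / 2) ((G k)\<^sup>2 / (C * real k powr \<tau>))"
    have k: "k \<ge> k0" "k \<ge> 1" "k \<ge> N1" "k \<ge> N2" "k \<ge> N3" using that by (auto simp: N_def)
    have tk: "real k powr (- \<tau>) \<le> 1" using k tau by (simp add: powr_minus_divide ge_one_powr_ge_zero)
    \<comment> \<open>The halving branch is constant in \<open>k\<close> and the quadratic one
      carries the factor \<open>k powr (- \<tau>) \<le> 1\<close>, so the latter scale bounds both
      from below.\<close>
    have d: "c * real k powr (- \<tau>) \<le> d"
    proof -
      have "c * real k powr (- \<tau>) \<le> c * 1" using c tk by (intro mult_left_mono) auto
      also have "\<dots> \<le> G k / 2" using N1[OF k(3)] min.cobounded1[of "\<epsilon> / 2" "\<epsilon>\<^sup>2 / C"]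
          unfolding c_def by linarith
      finally have 1: "c * real k powr (- \<tau>) \<le> G k / 2" .
      have "c * real k powr (- \<tau>) \<le> \<epsilon>\<^sup>2 / C * real k powr (- \<tau>)"
        by (intro mult_right_mono) (auto simp: c_def)
      also have "\<dots> \<le> (G k)\<^sup>2 / C * real k powr (- \<tau>)"
        using N1[OF k(3)] \<open>\<epsilon> > 0\<close> C by (intro mult_right_mono divide_right_mono power_mono) auto
      finally show ?thesis using 1 by (simp add: d_def powr_minus_divide)
    qed
    have d0: "0 \<le> d" using d c by (meson less_imp_le mult_nonneg_nonneg order_trans powr_ge_zero)
    have "a k \<le> K" using K(2)[OF k(4)] k by simp
    then have "p k * (a k - d) \<le> p k * K"
      using p(1)[OF k(1)] d0 by (intro mult_left_mono) auto
    also have "\<dots> \<le> C / k * K"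
      using p(2)[OF k(1)] K by (intro mult_right_mono) auto
    finally have 1: "p k * (a k - d) \<le> C * K / k" by simp
    have "real k powr (- 1 - \<tau>) \<le> real k powr (- 1)"
      using k tau by (intro powr_mono) auto
    then have "C * real k powr (- 1 - \<tau>) \<le> C * real k powr (- 1)"
      using C by (intro mult_left_mono) auto
    then have 2: "C * real k powr (- 1 - \<tau>) \<le> C / k" using k by (simp add: powr_minus_divide)
    have "(C * K + C) * real k powr (\<tau> - 1) \<le> c / 2"
      using N3[OF k(5)] C K by (simp add: field_simps add_pos_pos)
    then have "(C * K + C) * real k powr (\<tau> - 1) * real k powr (- \<tau>) \<le> c / 2 * real k powr (- \<tau>)"
      by (intro mult_right_mono) auto
    moreover have "real k powr (\<tau> - 1) * real k powr (- \<tau>) = 1 / k"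
      using k by (simp add: powr_minus_divide powr_diff)
    ultimately have 3: "C * K / k + C / k \<le> c / 2 * real k powr (- \<tau>)"
      by (simp add: mult.assoc add_divide_distrib)
    have "real k powr (- 1) \<le> real k powr (- \<tau>)"
      using k tau by (intro powr_mono) auto
    then have 4: "c / 2 * (1 / k) \<le> c / 2 * real k powr (- \<tau>)"
      using c k by (intro mult_left_mono) (auto simp: powr_minus_divide)
    have "a (Suc k) \<le> a k - d + p k * (a k - d) + C * real k powr (- 1 - \<tau>)"
      using step[OF k(1)] by (simp add: d_def algebra_simps)
    then show ?thesis using 1 2 3 4 d by linarith
  qed
  have sum: "a (n + N) \<le> a N - c / 2 * (\<Sum>i<n. 1 / real (i + N))" for n
  proof (induction n)
    case (Suc n)
    then show ?case using dec[of "n + N"] by (simp add: algebra_simps)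
  qed simp
  have "summable (\<lambda>i. 1 / real (i + N))"
  proof (rule summableI_nonneg_bounded[where x = "(a N - M) / (c / 2)"])
    fix n
    have "M \<le> a (n + N)" by (rule lower) (simp add: N_def)
    then show "(\<Sum>i<n. 1 / real (i + N)) \<le> (a N - M) / (c / 2)"
      using sum[of n] c by (simp add: field_simps)
  qed auto
  then have "summable (\<lambda>i. 1 / real i)"
    by (rule summable_iff_shift[THEN iffD1])
  then show False
    using not_summable_harmonic[where 'a = real] by (simp add: inverse_eq_divide)
qed

end

lemma subseq_tendsto_0:
  fixes G :: "nat \<Rightarrow> real"
  assumes "\<And>\<epsilon>. \<epsilon> > 0 \<Longrightarrow> \<exists>\<^sub>F k in sequentially. G k < \<epsilon>" "\<And>k. 0 \<le> G k"
  obtains r where "strict_mono r" "(G \<circ> r) \<longlonglongrightarrow> 0"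
proof -
  have ex: "\<exists>k>m. G k < 1 / real (Suc n)" for m n
    using assms(1)[of "1 / real (Suc n)"] unfolding frequently_sequentially by (auto dest!: spec[of _ "Suc m"] simp: Suc_le_eq)
  have "\<exists>r. \<forall>n. G (r n) < 1 / real (Suc n) \<and> r n < r (Suc n)"
    by (rule dependent_nat_choice) (use ex in blast)+
  then obtain r where r: "\<And>n. G (r n) < 1 / real (Suc n)" "\<And>n. r n < r (Suc n)" by blast
  have "(\<lambda>n. G (r n)) \<longlonglongrightarrow> 0"
  proof (rule tendsto_sandwich[where f = "\<lambda>_. 0" and h = "\<lambda>n. 1 / real (Suc n)"])
    show "(\<lambda>n. 1 / real (Suc n)) \<longlonglongrightarrow> 0"
      by (rule LIMSEQ_Suc[OF lim_1_over_n])
  qed (use r assms in \<open>auto intro!: always_eventually less_imp_le\<close>)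
  then show thesis
    using that[of r] r by (auto simp: strict_mono_Suc_iff o_def)
qed

subsection \<open>The composite program\<close>

lemma norm_vec_sq: "(norm (y :: real ^ 'm))\<^sup>2 = (\<Sum>i\<in>UNIV. (y $ i)\<^sup>2)"
  unfolding power2_norm_eq_inner inner_vec_def by (simp add: power2_eq_square)

lemma lin_argminD:
  assumes "v \<in> lin_argmin h u"
  shows "ereal (u \<bullet> v) + h v \<le> ereal (u \<bullet> y) + h y"
  using assms by (auto simp: lin_argmin_def is_arg_min_def not_less)

locale composite_program =
  fixes f :: "'a::euclidean_space \<Rightarrow> real" and h :: "'a \<Rightarrow> ereal" and g :: "'a \<Rightarrow> real ^ 'm"
    and Lf D :: real and Lg B :: "'m \<Rightarrow> real"
  assumes f_convex: "convex_on UNIV f" and f_diff: "\<And>y. f differentiable (at y)"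
    and Lf_pos: "Lf > 0" and f_lip: "Lf-lipschitz_on UNIV (grad f)"
    and h_proper: "proper_fun h" and h_closed: "closed_fun h" and h_convex: "convex_fun h"
    and D_pos: "D > 0" and dom_diam: "\<And>y y'. y \<in> effdom h \<Longrightarrow> y' \<in> effdom h \<Longrightarrow> norm (y - y') \<le> D"
    and g_convex: "\<And>i. convex_on UNIV (\<lambda>y. g y $ i)"
    and g_diff: "\<And>i y. (\<lambda>y. g y $ i) differentiable (at y)"
    and Lg_pos: "\<And>i. Lg i > 0" and grad_g_lip: "\<And>i. (Lg i)-lipschitz_on (effdom h) (grad (\<lambda>y. g y $ i))"
    and B_pos: "\<And>i. B i > 0"
    and grad_g_bound: "\<And>i y. y \<in> effdom h \<Longrightarrow> norm (grad (\<lambda>y. g y $ i) y) \<le> B i"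
    and g_lip: "\<And>i. (B i)-lipschitz_on (effdom h) (\<lambda>y. g y $ i)"
begin

text \<open>Real values of \<open>h\<close>, meaningful on the effective domain; the iterates stay
  there, so the estimates avoid extended arithmetic.\<close>

definition hr :: "'a \<Rightarrow> real" where "hr y = real_of_ereal (h y)"

lemma h_eq: "y \<in> effdom h \<Longrightarrow> h y = ereal (hr y)"
  using h_proper by (cases "h y") (auto simp: hr_def effdom_def proper_fun_def)

lemma h_infty: "y \<notin> effdom h \<Longrightarrow> h y = \<infinity>"
  by (auto simp: effdom_def)

lemma dom_nonempty: "effdom h \<noteq> {}"
  using h_proper by (simp add: proper_fun_def)

lemma hr_convex:
  assumes "y \<in> effdom h" "w \<in> effdom h" "0 \<le> t" "t \<le> 1"
  shows "y + t *\<^sub>R (w - y) \<in> effdom h" "hr (y + t *\<^sub>R (w - y)) \<le> hr y + t * (hr w - hr y)"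
proof -
  have "(y, hr y) \<in> epi h" "(w, hr w) \<in> epi h"
    using assms h_eq by (auto simp: epi_def)
  then have "(1 - t) *\<^sub>R (y, hr y) + t *\<^sub>R (w, hr w) \<in> epi h"
    using h_convex assms by (intro convexD_alt) (auto simp: convex_fun_def)
  then have *: "h (y + t *\<^sub>R (w - y)) \<le> ereal (hr y + t * (hr w - hr y))"
    by (simp add: epi_def algebra_simps)
  then show dom: "y + t *\<^sub>R (w - y) \<in> effdom h"
    unfolding effdom_def by (auto intro: le_less_trans)
  show "hr (y + t *\<^sub>R (w - y)) \<le> hr y + t * (hr w - hr y)"
    using * h_eq[OF dom] by simp
qed

lemma convex_dom: "convex (effdom h)"
  unfolding convex_alt using hr_convex(1) by (auto simp: algebra_simps)

lemma argmin_dom: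
  assumes "v \<in> lin_argmin h u"
  shows "v \<in> effdom h"
proof -
  obtain y where "y \<in> effdom h" using dom_nonempty by auto
  with lin_argminD[OF assms, of y] show ?thesis
    by (auto simp: effdom_def)
qed

lemma argmin_le:
  assumes "v \<in> lin_argmin h u" "y \<in> effdom h"
  shows "u \<bullet> v + hr v \<le> u \<bullet> y + hr y"
  using lin_argminD[OF assms(1), of y] h_eq[OF assms(2)] h_eq[OF argmin_dom[OF assms(1)]] by simp

section \<open>The augmented Lagrangian, its gap and the short step\<close>

lemma aug_F_eq:
  "l > 0 \<Longrightarrow> aug_F f g l y z = f y + (\<Sum>i\<in>UNIV. penalty l (g y $ i) (z $ i))"
  by (simp add: aug_F_def Psi_penalty)

lemma grad_F_eq:
  assumes l: "l > 0"
  shows "grad_F f g l y z = grad f y + (\<Sum>i\<in>UNIV. max (l * g y $ i + z $ i) 0 *\<^sub>R grad (\<lambda>y. g y $ i) y)"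
proof -
  have "((\<lambda>a. (max (l * a + b) 0)\<^sup>2) has_real_derivative 2 * max (l * a + b) 0 * l) (at a)" for a b
    by (rule DERIV_chain2[OF DERIV_sq_max0]) (auto intro!: derivative_eq_intros)
  from DERIV_cdivide[OF DERIV_diff[OF this DERIV_const]]
  have pen: "((\<lambda>a. penalty l a b) has_real_derivative max (l * a + b) 0) (at a)" for a b
    unfolding penalty_def by (rule DERIV_cong) (use l in simp)
  have "GDERIV (\<lambda>y. f y + (\<Sum>i\<in>UNIV. penalty l (g y $ i) (z $ i))) y :>
      grad f y + (\<Sum>i\<in>UNIV. max (l * g y $ i + z $ i) 0 *\<^sub>R grad (\<lambda>y. g y $ i) y)"
    by (intro GDERIV_add GDERIV_sum GDERIV_DERIV_compose GDERIV_grad f_diff g_diff pen)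
  then show ?thesis
    unfolding grad_F_def aug_F_eq[OF l] by (rule grad_eqI)
qed

text \<open>All minimizers give the linearized objective the same value, so the arbitrary choice
  inside \<open>gap\<close> may be replaced by the \<open>v\<close> at hand.\<close>

lemma gap_eq:
  assumes v: "v \<in> aug_argmin f h g l y z" and y: "y \<in> effdom h"
  shows "gap f h g l z y = ereal (grad_F f g l y z \<bullet> (y - v) + hr y - hr v)"
proof -
  define u where "u = (SOME v. v \<in> aug_argmin f h g l y z)"
  let ?d = "grad_F f g l y z"
  have u: "u \<in> aug_argmin f h g l y z" using v unfolding u_def by (rule someI)
  have "?d \<bullet> u + hr u = ?d \<bullet> v + hr v"
    using u v argmin_le argmin_dom unfolding aug_argmin_def by (meson order_antisym)
  moreover have "gap f h g l z y = ereal (?d \<bullet> (y - u) + hr y - hr u)"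
    unfolding gap_def Let_def u_def[symmetric]
    using u y h_eq argmin_dom by (simp add: aug_argmin_def)
  ultimately show ?thesis by (simp add: inner_diff_right)
qed

lemma gap_nonneg:
  assumes "v \<in> aug_argmin f h g l y z" "y \<in> effdom h"
  shows "0 \<le> grad_F f g l y z \<bullet> (y - v) + hr y - hr v"
  using argmin_le[of v "grad_F f g l y z" y] assms by (simp add: aug_argmin_def inner_diff_right)

text \<open>The slopes of the penalties are nonnegative, so multiplying the tangent inequalities of
  the constraints by them preserves their direction.\<close>

lemma aug_F_tangent:
  assumes l: "l > 0"
  shows "aug_F f g l y z + grad_F f g l y z \<bullet> (w - y) \<le> aug_F f g l w z"
proof -
  let ?m = "\<lambda>i. max (l * g y $ i + z $ i) 0"
  have "penalty l (g y $ i) (z $ i) + (?m i *\<^sub>R grad (\<lambda>y. g y $ i) y) \<bullet> (w - y) \<le> penalty l (g w $ i) (z $ i)" for i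
  proof -
    have "?m i * (grad (\<lambda>y. g y $ i) y \<bullet> (w - y)) \<le> ?m i * (g w $ i - g y $ i)"
      using convex_above_tangent[OF g_convex g_diff, of y i w] by (intro mult_left_mono) auto
    then show ?thesis using penalty_tangent[OF l, of "g y $ i" "z $ i" "g w $ i"] by simp
  qed
  then have "(\<Sum>i\<in>UNIV. penalty l (g y $ i) (z $ i)) + (\<Sum>i\<in>UNIV. ?m i *\<^sub>R grad (\<lambda>y. g y $ i) y) \<bullet> (w - y)
      \<le> (\<Sum>i\<in>UNIV. penalty l (g w $ i) (z $ i))"
    unfolding inner_sum_left sum.distrib[symmetric] by (rule sum_mono)
  then show ?thesis
    using convex_above_tangent[OF f_convex f_diff, of y w] l
    by (simp add: aug_F_eq grad_F_eq inner_add_left)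
qed

text \<open>The curvature \<open>l\<close> of the penalty meets the Lipschitz constant
  \<open>B i\<close> of the constraint, and its slope meets the descent lemma with
  \<open>Lg i\<close>. Their sum is \<open>L_Psi\<close>, evaluated at the base point
  \<open>y\<close> only.\<close>

lemma aug_F_quadratic_bound:
  assumes l: "l > 0" and y: "y \<in> effdom h" and w: "w \<in> effdom h"
  shows "aug_F f g l w z \<le> aug_F f g l y z + grad_F f g l y z \<bullet> (w - y)
      + (L_Psi B Lg g l y z + Lf) / 2 * (norm (w - y))\<^sup>2"
proof -
  let ?m = "\<lambda>i. max (l * g y $ i + z $ i) 0"
  have "penalty l (g w $ i) (z $ i) \<le> penalty l (g y $ i) (z $ i)
      + (?m i *\<^sub>R grad (\<lambda>y. g y $ i) y) \<bullet> (w - y) + (l * (B i)\<^sup>2 + Lg i * ?m i) * ((norm (w - y))\<^sup>2 / 2)" for i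
  proof -
    have "?m i * (g w $ i - g y $ i) \<le> ?m i * (grad (\<lambda>y. g y $ i) y \<bullet> (w - y) + Lg i / 2 * (norm (w - y))\<^sup>2)"
      using lipschitz_grad_quadratic_bound[OF g_diff grad_g_lip convex_dom y w, of i]
      by (intro mult_left_mono) auto
    moreover have "\<bar>g w $ i - g y $ i\<bar> \<le> B i * norm (w - y)"
      using lipschitz_onD[OF g_lip w y, of i] by (simp add: dist_norm)
    then have "(g w $ i - g y $ i)\<^sup>2 \<le> (B i * norm (w - y))\<^sup>2"
      by (metis abs_ge_zero power2_abs power_mono)
    then have "l / 2 * (g w $ i - g y $ i)\<^sup>2 \<le> l / 2 * (B i * norm (w - y))\<^sup>2"
      using l by (intro mult_left_mono) auto
    ultimately show ?thesis
      using penalty_quadratic_bound[OF l, of "g w $ i" "z $ i" "g y $ i"]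
      by (simp add: algebra_simps power_mult_distrib)
  qed
  then have "(\<Sum>i\<in>UNIV. penalty l (g w $ i) (z $ i)) \<le> (\<Sum>i\<in>UNIV. penalty l (g y $ i) (z $ i))
      + (\<Sum>i\<in>UNIV. ?m i *\<^sub>R grad (\<lambda>y. g y $ i) y) \<bullet> (w - y) + L_Psi B Lg g l y z * ((norm (w - y))\<^sup>2 / 2)"
    unfolding inner_sum_left L_Psi_def sum_distrib_right sum.distrib[symmetric] by (rule sum_mono)
  moreover have "f w \<le> f y + grad f y \<bullet> (w - y) + Lf / 2 * (norm (w - y))\<^sup>2"
    using lipschitz_grad_quadratic_bound[OF f_diff f_lip] by simp
  moreover have "(L_Psi B Lg g l y z + Lf) / 2 * (norm (w - y))\<^sup>2
     = L_Psi B Lg g l y z * ((norm (w - y))\<^sup>2 / 2) + Lf / 2 * (norm (w - y))\<^sup>2"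
    by (simp add: algebra_simps add_divide_distrib)
  ultimately show ?thesis
    unfolding aug_F_eq[OF l] grad_F_eq[OF l] inner_add_left by linarith
qed

lemma L_Psi_nonneg: "l > 0 \<Longrightarrow> 0 \<le> L_Psi B Lg g l y z"
  unfolding L_Psi_def using Lg_pos by (intro sum_nonneg add_nonneg_nonneg mult_nonneg_nonneg) (auto intro: less_imp_le)

text \<open>With \<open>M = L_Psi + Lf\<close> and \<open>n = norm (v - y)\<close>, the short step
  maximizes the guaranteed decrease \<open>\<alpha> * G - M / 2 * (\<alpha> * n)\<^sup>2\<close>
  over \<open>[0, 1]\<close>. A full step gains at least \<open>G / 2\<close>, an interior one
  \<open>G\<^sup>2 / (2 * (M * n\<^sup>2))\<close>.\<close>

lemma short_step_decrease:
  assumes l: "l > 0" and y: "y \<in> effdom h" and v: "v \<in> aug_argmin f h g l y z"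
    and L: "(L_Psi B Lg g l y z + Lf) * (norm (v - y))\<^sup>2 \<le> L" "L > 0"
  defines "G \<equiv> grad_F f g l y z \<bullet> (y - v) + hr y - hr v"
    and "w \<equiv> y + short_step f h g Lf Lg B y z v l *\<^sub>R (v - y)"
  shows "aug_F f g l w z + hr w \<le> aug_F f g l y z + hr y - min (G / 2) (G\<^sup>2 / (2 * L))"
proof -
  define M where "M = L_Psi B Lg g l y z + Lf"
  define n where "n = norm (v - y)"
  define \<alpha> where "\<alpha> = short_step f h g Lf Lg B y z v l"
  have M: "M > 0" using L_Psi_nonneg[OF l] Lf_pos by (simp add: M_def add_nonneg_pos)
  have G: "gap f h g l z y = ereal G" "G \<ge> 0"
    using gap_eq gap_nonneg v y by (auto simp: G_def)
  have \<alpha>: "\<alpha> = (if n = 0 then 0 else min 1 (G / (M * n\<^sup>2)))"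
  proof (cases "n = 0")
    case True
    \<comment> \<open>A vanishing direction forces a zero gap, so the stepsize takes its default
      value 0.\<close>
    then have "G = 0" by (simp add: n_def G_def)
    then show ?thesis using True by (simp add: \<alpha>_def short_step_def G n_def)
  next
    case False
    then have "M * n\<^sup>2 \<noteq> 0" using M by simp
    then have "\<alpha> = real_of_ereal (min 1 (ereal (G / (M * n\<^sup>2))))"
      using False by (simp add: \<alpha>_def short_step_def G n_def M_def)
    also have "min 1 (ereal (G / (M * n\<^sup>2))) = ereal (min 1 (G / (M * n\<^sup>2)))"
      by (simp add: min_def one_ereal_def)
    finally show ?thesis using False by (simp only: real_of_ereal.simps if_False)
  qed
  have a01: "0 \<le> \<alpha>" "\<alpha> \<le> 1" using \<alpha> G M by (auto simp: n_def)
  have vd: "v \<in> effdom h" using v argmin_dom by (auto simp: aug_argmin_def)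
  have w: "w = y + \<alpha> *\<^sub>R (v - y)" by (simp add: w_def \<alpha>_def)
  have wd: "w \<in> effdom h" "hr w \<le> hr y + \<alpha> * (hr v - hr y)"
    unfolding w using hr_convex y vd a01 by auto
  have "norm (w - y) = \<alpha> * n" using a01 by (simp add: w n_def)
  then have "aug_F f g l w z \<le> aug_F f g l y z + \<alpha> * (grad_F f g l y z \<bullet> (v - y)) + M / 2 * (\<alpha> * n)\<^sup>2"
    using aug_F_quadratic_bound[OF l y wd(1), of z] by (simp add: w M_def)
  moreover have "\<alpha> * (grad_F f g l y z \<bullet> (v - y)) + \<alpha> * (hr v - hr y) = - (\<alpha> * G)"
    by (simp add: G_def inner_diff_right algebra_simps)
  ultimately have "aug_F f g l w z + hr w \<le> aug_F f g l y z + hr y - (\<alpha> * G - M / 2 * (\<alpha> * n)\<^sup>2)"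
    using wd(2) by linarith
  moreover have "min (G / 2) (G\<^sup>2 / (2 * L)) \<le> \<alpha> * G - M / 2 * (\<alpha> * n)\<^sup>2"
  proof (cases "n = 0")
    case True
    then show ?thesis using \<alpha> by (simp add: n_def G_def)
  next
    case False
    then have Mn: "M * n\<^sup>2 > 0" using M by (simp add: n_def)
    show ?thesis
    proof (cases "1 \<le> G / (M * n\<^sup>2)")
      case True
      then have "\<alpha> = 1" "M * n\<^sup>2 \<le> G" using \<alpha> False Mn by (auto simp: field_simps)
      then show ?thesis by simp
    next
      case F: False
      then have "\<alpha> = G / (M * n\<^sup>2)" using \<alpha> False by simp
      then have "\<alpha> * G - M / 2 * (\<alpha> * n)\<^sup>2 = G\<^sup>2 / (2 * (M * n\<^sup>2))"
        using Mn by (simp add: field_simps power2_eq_square)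
      moreover have "G\<^sup>2 / (2 * L) \<le> G\<^sup>2 / (2 * (M * n\<^sup>2))"
        using L Mn by (intro divide_left_mono) (auto simp: M_def n_def)
      ultimately show ?thesis by simp
    qed
  qed
  ultimately show ?thesis by linarith
qed

section \<open>Bounds on the constraints and passage to the limit\<close>

lemma g_tendsto: "(X \<longlongrightarrow> y) F \<Longrightarrow> ((\<lambda>n. g (X n) $ i) \<longlongrightarrow> g y $ i) F"
  using isCont_tendsto_compose[OF differentiable_imp_continuous_within[OF g_diff]] .

lemma g_bounded: obtains M where "M \<ge> 0" "\<And>y i. y \<in> effdom h \<Longrightarrow> \<bar>g y $ i\<bar> \<le> M"
proof -
  obtain u where u: "u \<in> effdom h" using dom_nonempty by auto
  define M where "M = (\<Sum>i\<in>UNIV. \<bar>g u $ i\<bar> + B i * D)"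
  have nonneg: "0 \<le> \<bar>g u $ i\<bar> + B i * D" for i
    using B_pos[of i] D_pos by simp
  have "\<bar>g y $ i\<bar> \<le> M" if y: "y \<in> effdom h" for y i
  proof -
    have "\<bar>g y $ i - g u $ i\<bar> \<le> B i * norm (y - u)"
      using lipschitz_onD[OF g_lip y u, of i] by (simp add: dist_norm)
    also have "\<dots> \<le> B i * D"
      using dom_diam[OF y u] B_pos[of i] by (intro mult_left_mono) auto
    finally have "\<bar>g y $ i\<bar> \<le> \<bar>g u $ i\<bar> + B i * D" by linarith
    also have "\<dots> \<le> M"
      unfolding M_def by (rule member_le_sum) (use nonneg in auto)
    finally show ?thesis .
  qed
  moreover have "M \<ge> 0" unfolding M_def using nonneg by (rule sum_nonneg)
  ultimately show thesis using that by blast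
qed

text \<open>The gradients of the constraints are controlled on the effective domain only, so a crude bound
  on \<open>h\<close> along the sequence first places the limit in it.\<close>

lemma limit_stationary:
  fixes W :: "nat \<Rightarrow> real ^ 'm"
  defines "d \<equiv> \<lambda>y w. grad f y + (\<Sum>i\<in>UNIV. w $ i *\<^sub>R grad (\<lambda>y. g y $ i) y)"
  assumes X: "\<And>n. X n \<in> effdom h" "X \<longlonglongrightarrow> y" and W: "W \<longlonglongrightarrow> w" and e: "e \<longlonglongrightarrow> 0"
    and gap: "\<And>n u. u \<in> effdom h \<Longrightarrow> d (X n) (W n) \<bullet> (X n - u) + hr (X n) - hr u \<le> e n"
  shows "y \<in> effdom h" "- d y w \<in> subdifferential h y"
proof -
  \<comment> \<open>Closedness of the epigraph transfers upper bounds to the limit before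
    \<open>y\<close> is known to lie in the domain.\<close>
  have lsc: "h y \<le> ereal t" if T: "T \<longlonglongrightarrow> t" and le: "\<And>n. hr (X n) \<le> T n" for T t
  proof -
    have "(\<lambda>n. (X n, T n)) \<longlonglongrightarrow> (y, t)" using X T by (intro tendsto_Pair)
    moreover have "(X n, T n) \<in> epi h" for n
      using le h_eq[OF X(1)] by (simp add: epi_def)
    ultimately have "(y, t) \<in> epi h"
      using closed_sequentially[OF h_closed[unfolded closed_fun_def], of "\<lambda>n. (X n, T n)"] by simp
    then show ?thesis by (simp add: epi_def)
  qed
  have grad_f: "(\<lambda>n. grad f (X n)) \<longlonglongrightarrow> grad f y"
    using continuous_on_tendsto_compose[OF lipschitz_on_continuous_on[OF f_lip] X(2)] by simp
  have Wi: "(\<lambda>n. W n $ i) \<longlonglongrightarrow> w $ i" for i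
    using W by (rule tendsto_vec_nth)
  obtain u where u: "u \<in> effdom h" using dom_nonempty by auto
  \<comment> \<open>The constraint gradients are not yet known to converge; Cauchy-Schwarz replaces
    them by \<open>B i\<close> and the distance by \<open>D\<close>, leaving only convergent
    quantities.\<close>
  have "h y \<le> ereal (0 + hr u + (norm (grad f y) + (\<Sum>i\<in>UNIV. \<bar>w $ i\<bar> * B i)) * D)"
  proof (rule lsc)
    show "(\<lambda>n. e n + hr u + (norm (grad f (X n)) + (\<Sum>i\<in>UNIV. \<bar>W n $ i\<bar> * B i)) * D)
        \<longlonglongrightarrow> 0 + hr u + (norm (grad f y) + (\<Sum>i\<in>UNIV. \<bar>w $ i\<bar> * B i)) * D"
      by (intro tendsto_intros e grad_f Wi)
    fix n
    have "norm (d (X n) (W n)) \<le> norm (grad f (X n)) + (\<Sum>i\<in>UNIV. norm (W n $ i *\<^sub>R grad (\<lambda>y. g y $ i) (X n)))"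
      unfolding d_def by (rule order_trans[OF norm_triangle_ineq add_left_mono[OF norm_sum]])
    also have "\<dots> \<le> norm (grad f (X n)) + (\<Sum>i\<in>UNIV. \<bar>W n $ i\<bar> * B i)"
      using grad_g_bound[OF X(1)] by (auto intro!: add_left_mono sum_mono mult_left_mono)
    finally have "norm (d (X n) (W n)) * norm (u - X n) \<le> (norm (grad f (X n)) + (\<Sum>i\<in>UNIV. \<bar>W n $ i\<bar> * B i)) * D"
      using dom_diam[OF u X(1)] by (intro mult_mono) (auto intro: order_trans[OF norm_ge_zero])
    then have "d (X n) (W n) \<bullet> (u - X n) \<le> (norm (grad f (X n)) + (\<Sum>i\<in>UNIV. \<bar>W n $ i\<bar> * B i)) * D"
      by (rule order_trans[OF norm_cauchy_schwarz])
    then show "hr (X n) \<le> e n + hr u + (norm (grad f (X n)) + (\<Sum>i\<in>UNIV. \<bar>W n $ i\<bar> * B i)) * D"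
      using gap[OF u, of n] by (simp add: inner_diff_right)
  qed
  then show y: "y \<in> effdom h"
    unfolding effdom_def by (auto intro: le_less_trans)
  \<comment> \<open>With \<open>y\<close> in the domain, the Lipschitz condition there makes the
    gradients converge, and the exact bound can be passed to the limit.\<close>
  have "(\<lambda>n. grad (\<lambda>y. g y $ i) (X n)) \<longlonglongrightarrow> grad (\<lambda>y. g y $ i) y" for i
    using continuous_on_tendsto_compose[OF lipschitz_on_continuous_on[OF grad_g_lip] X(2) y] X(1) by simp
  then have d: "(\<lambda>n. d (X n) (W n)) \<longlonglongrightarrow> d y w"
    unfolding d_def by (intro tendsto_intros grad_f Wi)
  have le: "h y \<le> ereal (0 + hr u + d y w \<bullet> (u - y))" if u: "u \<in> effdom h" for u
  proof (rule lsc)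
    show "(\<lambda>n. e n + hr u + d (X n) (W n) \<bullet> (u - X n)) \<longlonglongrightarrow> 0 + hr u + d y w \<bullet> (u - y)"
      by (intro tendsto_intros e d X)
    show "hr (X n) \<le> e n + hr u + d (X n) (W n) \<bullet> (u - X n)" for n
      using gap[OF u, of n] by (simp add: inner_diff_right)
  qed
  have "h y + ereal (- d y w \<bullet> (u - y)) \<le> h u" for u
    using le[of u] h_eq[OF y] h_eq[of u] h_infty[of u] by (cases "u \<in> effdom h") auto
  then show "- d y w \<in> subdifferential h y"
    by (simp add: subdifferential_def)
qed

end

subsection \<open>Excess over the optimal value\<close>

locale composite_program_kkt = composite_program f h g Lf D Lg B
  for f :: "'a::euclidean_space \<Rightarrow> real" and h and g :: "'a \<Rightarrow> real ^ 'm" and Lf D Lg B +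
  fixes xs :: 'a and zs :: "real ^ 'm"
  assumes kkt: "kkt_point f h g xs zs"
begin

definition opt :: real where "opt = f xs + hr xs"

text \<open>Measured against the value of the constrained program and not the minimum of the
  augmented Lagrangian, hence possibly negative.\<close>

definition excess :: "real \<Rightarrow> 'a \<Rightarrow> real ^ 'm \<Rightarrow> real" where
  "excess l y z = aug_F f g l y z + hr y - opt"

lemma feasible: "g xs $ i \<le> 0" "0 \<le> zs $ i" "g xs \<le> 0"
  using kkt by (auto simp: kkt_point_def less_eq_vec_def)

lemma kkt_subgradient:
  obtains s where "s \<in> subdifferential h xs"
    "grad f xs + s + (\<Sum>i\<in>UNIV. zs $ i *\<^sub>R grad (\<lambda>y. g y $ i) xs) = 0"
  using kkt by (auto simp: kkt_point_def)

lemma xs_dom: "xs \<in> effdom h"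
proof -
  obtain s where s: "s \<in> subdifferential h xs" by (rule kkt_subgradient)
  obtain y where y: "y \<in> effdom h" using dom_nonempty by auto
  have "h xs + ereal (s \<bullet> (y - xs)) \<le> h y" using s by (simp add: subdifferential_def)
  then show ?thesis using y by (auto simp: effdom_def)
qed

text \<open>The point \<open>xs\<close> minimizes the Lagrangian with multiplier \<open>zs\<close>:
  in the sum of the tangent inequalities the linear terms cancel by stationarity, and
  complementarity removes the multiplier term at \<open>xs\<close>.\<close>

lemma lagrangian_ge_opt:
  assumes y: "y \<in> effdom h"
  shows "opt \<le> f y + hr y + zs \<bullet> g y"
proof -
  obtain s where s: "s \<in> subdifferential h xs"
    and s0: "grad f xs + s + (\<Sum>i\<in>UNIV. zs $ i *\<^sub>R grad (\<lambda>y. g y $ i) xs) = 0"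
    by (rule kkt_subgradient)
  have "h xs + ereal (s \<bullet> (y - xs)) \<le> h y" using s by (simp add: subdifferential_def)
  then have 1: "hr xs + s \<bullet> (y - xs) \<le> hr y"
    using h_eq[OF y] h_eq[OF xs_dom] by simp
  have 2: "f xs + grad f xs \<bullet> (y - xs) \<le> f y"
    by (rule convex_above_tangent[OF f_convex f_diff])
  have "zs $ i * (g xs $ i + grad (\<lambda>y. g y $ i) xs \<bullet> (y - xs)) \<le> zs $ i * g y $ i" for i
    using feasible convex_above_tangent[OF g_convex g_diff] by (intro mult_left_mono) auto
  then have "(\<Sum>i\<in>UNIV. zs $ i * (g xs $ i + grad (\<lambda>y. g y $ i) xs \<bullet> (y - xs))) \<le> (\<Sum>i\<in>UNIV. zs $ i * g y $ i)"
    by (rule sum_mono)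
  then have "zs \<bullet> g xs + (\<Sum>i\<in>UNIV. zs $ i *\<^sub>R grad (\<lambda>y. g y $ i) xs) \<bullet> (y - xs) \<le> zs \<bullet> g y"
    by (simp add: inner_vec_def inner_sum_left distrib_left sum.distrib)
  moreover have "zs \<bullet> g xs = 0" using kkt by (simp add: kkt_point_def)
  moreover have "grad f xs \<bullet> (y - xs) + s \<bullet> (y - xs)
      + (\<Sum>i\<in>UNIV. zs $ i *\<^sub>R grad (\<lambda>y. g y $ i) xs) \<bullet> (y - xs) = 0"
    using s0 by (metis inner_add_left inner_zero_left)
  ultimately show ?thesis using 1 2 unfolding opt_def by linarith
qed

text \<open>Weak duality bounds the objective from below at feasible points, and \<open>xs\<close>
  attains the bound.\<close>

lemma opt_value_eq: "opt_value f h g = ereal opt"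
  unfolding opt_value_def
proof (rule INF_eqI)
  fix y assume "y \<in> {x. g x \<le> 0}"
  then have "g y $ i \<le> 0" for i by (simp add: less_eq_vec_def)
  then have "zs \<bullet> g y \<le> 0"
    using feasible by (auto simp: inner_vec_def intro!: sum_nonpos mult_nonneg_nonpos)
  then show "ereal opt \<le> ereal (f y) + h y"
    using lagrangian_ge_opt[of y] h_eq[of y] h_infty[of y] by (cases "y \<in> effdom h") auto
next
  fix b assume "\<And>y. y \<in> {x. g x \<le> 0} \<Longrightarrow> b \<le> ereal (f y) + h y"
  from this[of xs] show "b \<le> ereal opt"
    using feasible h_eq[OF xs_dom] by (simp add: opt_def)
qed

text \<open>Compare with \<open>xs\<close>: its penalties are nonpositive by feasibility, the
  tangent inequality bounds the Lagrangian there from below, and \<open>v\<close> does at least as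
  well as \<open>xs\<close> in the linearized problem.\<close>

lemma excess_le_gap:
  assumes l: "l > 0" and z: "0 \<le> z" and v: "v \<in> aug_argmin f h g l y z"
  shows "excess l y z \<le> grad_F f g l y z \<bullet> (y - v) + hr y - hr v"
proof -
  have "aug_F f g l xs z \<le> f xs"
    using l z feasible by (auto simp: aug_F_eq less_eq_vec_def intro!: sum_nonpos penalty_nonpos)
  then show ?thesis
    using argmin_le[of v "grad_F f g l y z" xs] v xs_dom aug_F_tangent[OF l, of y z xs]
    by (simp add: excess_def opt_def aug_argmin_def inner_diff_right)
qed

text \<open>Subtracting \<open>zs \<bullet> g y\<close> from the penalties leaves the quadratic
  violation up to a term of order \<open>1 / l\<close>; the ordinary Lagrangian that remains is at
  least \<open>opt\<close>.\<close>

lemma excess_lower_bound: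
  assumes l: "l > 0" and z: "0 \<le> z" and y: "y \<in> effdom h"
  shows "l / 4 * (norm (pos_part (g y)))\<^sup>2 - ((norm zs)\<^sup>2 + (norm z)\<^sup>2) / l \<le> excess l y z"
proof -
  have "l / 4 * (max (g y $ i) 0)\<^sup>2 - ((zs $ i)\<^sup>2 + (z $ i)\<^sup>2) / l
      \<le> penalty l (g y $ i) (z $ i) - zs $ i * g y $ i" for i
    using z feasible l by (intro penalty_ge_quadratic) (auto simp: less_eq_vec_def)
  then have "(\<Sum>i\<in>UNIV. l / 4 * (max (g y $ i) 0)\<^sup>2 - ((zs $ i)\<^sup>2 + (z $ i)\<^sup>2) / l)
      \<le> (\<Sum>i\<in>UNIV. penalty l (g y $ i) (z $ i) - zs $ i * g y $ i)"
    by (rule sum_mono)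
  moreover have "(\<Sum>i\<in>UNIV. ((zs $ i)\<^sup>2 + (z $ i)\<^sup>2) / l) = ((norm zs)\<^sup>2 + (norm z)\<^sup>2) / l"
    by (simp add: norm_vec_sq flip: sum.distrib sum_divide_distrib)
  moreover have "(\<Sum>i\<in>UNIV. l / 4 * (max (g y $ i) 0)\<^sup>2) = l / 4 * (norm (pos_part (g y)))\<^sup>2"
    by (simp only: norm_vec_sq pos_part_def vec_lambda_beta sum_distrib_left)
  ultimately show ?thesis
    using lagrangian_ge_opt[OF y] l by (simp add: excess_def aug_F_eq sum_subtractf inner_vec_def)
qed

section \<open>Cost of updating the penalty parameter and the multiplier\<close>

lemma sum_sq_max_le:
  assumes l: "l > 0" and z: "0 \<le> z"
  shows "(\<Sum>i\<in>UNIV. (max (g y $ i) (- z $ i / l))\<^sup>2) \<le> (norm (pos_part (g y)))\<^sup>2 + (norm z)\<^sup>2 / l\<^sup>2"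
proof -
  have "(\<Sum>i\<in>UNIV. (max (g y $ i) (- z $ i / l))\<^sup>2) \<le> (\<Sum>i\<in>UNIV. (max (g y $ i) 0)\<^sup>2 + (z $ i / l)\<^sup>2)"
    using l z by (intro sum_mono sq_max_le) (auto simp: less_eq_vec_def)
  also have "\<dots> = (norm (pos_part (g y)))\<^sup>2 + (norm z)\<^sup>2 / l\<^sup>2"
    by (simp add: norm_vec_sq pos_part_def sum.distrib power_divide sum_divide_distrib)
  finally show ?thesis .
qed

lemma excess_param_bound:
  assumes l: "0 < l" "l \<le> l'" and z: "0 \<le> z"
  shows "excess l' y z \<le> excess l y z + (l' - l) / 2 * ((norm (pos_part (g y)))\<^sup>2 + (norm z)\<^sup>2 / l\<^sup>2)"
proof -
  have "(\<Sum>i\<in>UNIV. penalty l' (g y $ i) (z $ i))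
      \<le> (\<Sum>i\<in>UNIV. penalty l (g y $ i) (z $ i) + (l' - l) / 2 * (max (g y $ i) (- z $ i / l))\<^sup>2)"
    using l z by (intro sum_mono penalty_param_bound) (auto simp: less_eq_vec_def)
  moreover have "(l' - l) / 2 * (\<Sum>i\<in>UNIV. (max (g y $ i) (- z $ i / l))\<^sup>2)
      \<le> (l' - l) / 2 * ((norm (pos_part (g y)))\<^sup>2 + (norm z)\<^sup>2 / l\<^sup>2)"
    using l z by (intro mult_left_mono sum_sq_max_le) auto
  moreover have l': "l' > 0" using l by simp
  ultimately show ?thesis
    unfolding sum.distrib sum_distrib_left[symmetric] excess_def aug_F_eq[OF l(1)] aug_F_eq[OF l']
    by linarith
qed

lemma excess_multiplier_bound:
  assumes l: "0 < l" and z: "0 \<le> z" and s: "0 \<le> s"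
  shows "excess l y (z + s *\<^sub>R (\<chi> i. max (- (z $ i) / l) (g y $ i)))
    \<le> excess l y z + s * ((norm (pos_part (g y)))\<^sup>2 + (norm z)\<^sup>2 / l\<^sup>2)"
proof -
  have "(\<Sum>i\<in>UNIV. penalty l (g y $ i) (z $ i + s * max (- z $ i / l) (g y $ i)))
      \<le> (\<Sum>i\<in>UNIV. penalty l (g y $ i) (z $ i) + s * (max (g y $ i) (- z $ i / l))\<^sup>2)"
    using l by (intro sum_mono penalty_multiplier_bound)
  moreover have "s * (\<Sum>i\<in>UNIV. (max (g y $ i) (- z $ i / l))\<^sup>2)
      \<le> s * ((norm (pos_part (g y)))\<^sup>2 + (norm z)\<^sup>2 / l\<^sup>2)"
    using l z s by (intro mult_left_mono sum_sq_max_le) auto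
  ultimately show ?thesis
    using l unfolding sum.distrib sum_distrib_left[symmetric] by (simp add: excess_def aug_F_eq)
qed

section \<open>From excess and violation to the objective error\<close>

lemma objective_le:
  assumes l: "0 < l"
  shows "f y + hr y - opt \<le> excess l y z + (norm z)\<^sup>2 / (2 * l)"
proof -
  \<comment> \<open>The dual weight 0 gives the least value the penalty can take.\<close>
  have "(\<Sum>i\<in>UNIV. - ((z $ i)\<^sup>2 / (2 * l))) \<le> (\<Sum>i\<in>UNIV. penalty l (g y $ i) (z $ i))"
    using penalty_ge_linear[OF l, of 0] by (intro sum_mono) simp
  then show ?thesis
    using l by (simp add: excess_def aug_F_eq norm_vec_sq sum_negf sum_divide_distrib)
qed

lemma objective_ge:
  assumes "y \<in> effdom h"
  shows "- (norm zs * norm (pos_part (g y))) \<le> f y + hr y - opt"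
proof -
  have "zs \<bullet> g y \<le> zs \<bullet> pos_part (g y)"
    unfolding inner_vec_def using feasible by (intro sum_mono) (auto simp: pos_part_def intro: mult_left_mono)
  also have "\<dots> \<le> norm zs * norm (pos_part (g y))" by (rule norm_cauchy_schwarz)
  finally show ?thesis using lagrangian_ge_opt[OF assms] by linarith
qed

lemma err_eq:
  assumes "y \<in> effdom h"
  shows "err f h g y = ereal (max \<bar>f y + hr y - opt\<bar> (norm (pos_part (g y))))"
  using h_eq[OF assms] by (simp add: err_def opt_value_eq max_def)

end

subsection \<open>Runs of the single-loop algorithm\<close>

locale single_loop_run = composite_program_kkt f h g Lf D Lg B xs zs
  for f :: "'a::euclidean_space \<Rightarrow> real" and h and g :: "'a \<Rightarrow> real ^ 'm" and Lf D Lg B xs zs +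
  fixes lam sig alp :: "nat \<Rightarrow> real" and x v :: "nat \<Rightarrow> 'a" and z :: "nat \<Rightarrow> real ^ 'm" and \<tau> \<gamma> :: real
  assumes alg: "single_loop f h g lam sig alp x z v"
    and tau: "0 < \<tau>" "\<tau> < 1"
    and lam_rate: "lam \<in> \<Theta>(\<lambda>k. real k powr \<tau>)"
      "(\<lambda>k. lam (Suc k) - lam k) \<in> O(\<lambda>k. real k powr (- (1 - \<tau>)))"
    and alp_def: "\<And>k. alp k = short_step f h g Lf Lg B (x k) (z k) (v k) (lam k)"
    and sig_rate: "\<gamma> > 0" "sig \<in> \<Theta>(\<lambda>k. real k powr (- (1 + \<gamma>)))"
begin

section \<open>Invariants of the iterates\<close>

lemma params:
  "x 0 \<in> effdom h" "0 \<le> z 0 $ i" "0 < lam k" "lam k < lam (Suc k)" "filterlim lam at_top sequentially"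
  "0 < sig k" "sig k \<le> lam k" "summable sig" "0 \<le> alp k" "alp k \<le> 1"
  and v: "v k \<in> aug_argmin f h g (lam k) (x k) (z k)"
  and x_Suc: "x (Suc k) = x k + alp k *\<^sub>R (v k - x k)"
  and z_Suc: "z (Suc k) = z k + sig k *\<^sub>R (\<chi> i. max (- (z k $ i) / lam k) (g (x (Suc k)) $ i))"
  using alg unfolding single_loop_def by (auto simp: less_eq_vec_def)

lemma x_dom: "x k \<in> effdom h"
proof (induction k)
  case (Suc k)
  have "v k \<in> effdom h" using v argmin_dom by (auto simp: aug_argmin_def)
  then show ?case unfolding x_Suc using Suc params by (intro hr_convex) auto
qed (rule params)

lemma z_nonneg: "0 \<le> z k $ i"
proof (induction k)
  case (Suc k)
  \<comment> \<open>By \<open>sig k \<le> lam k\<close>, the update removes at most the whole of a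
    multiplier.\<close>
  have "z k $ i * (sig k / lam k) \<le> z k $ i * 1"
    using Suc params(3,7)[of k] by (intro mult_left_mono) auto
  then have "0 \<le> z k $ i + sig k * (- (z k $ i) / lam k)"
    by (simp add: mult.commute)
  also have "\<dots> \<le> z k $ i + sig k * max (- (z k $ i) / lam k) (g (x (Suc k)) $ i)"
    using params(6)[of k] by (intro add_left_mono mult_left_mono) auto
  also have "\<dots> = z (Suc k) $ i"
    by (simp add: z_Suc)
  finally show ?case .
qed (rule params)

lemma z_ge_0: "0 \<le> z k"
  using z_nonneg by (simp add: less_eq_vec_def)

text \<open>An update raises a component by at most \<open>sig k\<close> times a bound on the
  constraints, and \<open>sig\<close> is summable.\<close>

lemma z_bounded: obtains Z where "Z \<ge> 0" "\<And>k. norm (z k) \<le> Z"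
proof -
  obtain M where M: "M \<ge> 0" "\<And>y i. y \<in> effdom h \<Longrightarrow> \<bar>g y $ i\<bar> \<le> M" using g_bounded by blast
  have le: "z k $ i \<le> z 0 $ i + M * (\<Sum>j<k. sig j)" for k i
  proof (induction k)
    case (Suc k)
    have "max (- (z k $ i) / lam k) (g (x (Suc k)) $ i) \<le> M"
    proof -
      have "- (z k $ i) / lam k \<le> 0"
        using params(3)[of k] z_nonneg[of k i] by (simp add: divide_nonpos_pos)
      moreover have "g (x (Suc k)) $ i \<le> M" using M(2)[OF x_dom, of "Suc k" i] by simp
      ultimately show ?thesis using M(1) by simp
    qed
    then have "sig k * max (- (z k $ i) / lam k) (g (x (Suc k)) $ i) \<le> sig k * M"
      using params(6)[of k] by (intro mult_left_mono) auto
    then show ?case using Suc by (simp add: z_Suc algebra_simps)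
  qed simp
  have z_le: "\<bar>z k $ i\<bar> \<le> z 0 $ i + M * suminf sig" for k i
  proof -
    have "(\<Sum>j<k. sig j) \<le> suminf sig"
      using params(6,8) by (intro sum_le_suminf) (auto intro: less_imp_le)
    then have "M * (\<Sum>j<k. sig j) \<le> M * suminf sig" using M by (intro mult_left_mono)
    then show ?thesis using le[of k i] z_nonneg[of k i] by simp
  qed
  have "norm (z k) \<le> (\<Sum>i\<in>UNIV. z 0 $ i + M * suminf sig)" for k
    by (rule order_trans[OF norm_le_l1_cart sum_mono]) (rule z_le)
  then show thesis using that norm_ge_zero order_trans by metis
qed

section \<open>The recursion for the excess\<close>

definition a :: "nat \<Rightarrow> real" where "a k = excess (lam k) (x k) (z k)"

definition G :: "nat \<Rightarrow> real" where
  "G k = grad_F f g (lam k) (x k) (z k) \<bullet> (x k - v k) + hr (x k) - hr (v k)"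

text \<open>The combined weight of both updates in front of the squared violation. The parameter
  increment is halved because the derivative of the penalty in \<open>l\<close> is half a
  square.\<close>

definition growth :: "nat \<Rightarrow> real" where "growth k = sig k + (lam (Suc k) - lam k) / 2"

lemma growth_nonneg: "0 \<le> growth k"
  using params(4,6)[of k] by (simp add: growth_def)

lemma G_nonneg: "0 \<le> G k"
  unfolding G_def by (rule gap_nonneg[OF v x_dom])

lemma a_le_G: "a k \<le> G k"
  unfolding a_def G_def by (rule excess_le_gap[OF params(3) z_ge_0 v])

lemma parameter_bounds:
  obtains c1 c2 c3 N where "c1 > 0" "c2 > 0" "c3 > 0" "N \<ge> 1"
    "\<And>k. k \<ge> N \<Longrightarrow> c1 * real k powr \<tau> \<le> lam k" "\<And>k. k \<ge> N \<Longrightarrow> lam k \<le> c2 * real k powr \<tau>"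
    "\<And>k. k \<ge> N \<Longrightarrow> growth k \<le> c3 * real k powr (\<tau> - 1)"
proof -
  obtain c2 where c2: "c2 > 0" "\<forall>\<^sub>F k in sequentially. norm (lam k) \<le> c2 * norm (real k powr \<tau>)"
    using bigthetaD1[OF lam_rate(1)] by (rule landau_o.bigE)
  obtain c1 where c1: "c1 > 0" "\<forall>\<^sub>F k in sequentially. norm (lam k) \<ge> c1 * norm (real k powr \<tau>)"
    using bigthetaD2[OF lam_rate(1)] by (rule landau_omega.bigE)
  obtain d where d: "d > 0"
    "\<forall>\<^sub>F k in sequentially. norm (lam (Suc k) - lam k) \<le> d * norm (real k powr (- (1 - \<tau>)))"
    using lam_rate(2) by (rule landau_o.bigE)
  obtain b where b: "b > 0" "\<forall>\<^sub>F k in sequentially. norm (sig k) \<le> b * norm (real k powr (- (1 + \<gamma>)))"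
    using bigthetaD1[OF sig_rate(2)] by (rule landau_o.bigE)
  have "\<forall>\<^sub>F k in sequentially. k \<ge> 1 \<and> c1 * real k powr \<tau> \<le> lam k \<and> lam k \<le> c2 * real k powr \<tau>
      \<and> growth k \<le> (b + d) * real k powr (\<tau> - 1)"
    using eventually_ge_at_top[of 1] c1(2) c2(2) d(2) b(2)
  proof eventually_elim
    case (elim k)
    \<comment> \<open>The multiplier steps decay faster than the allowed increments of
      \<open>lam\<close>, so the latter set the order of \<open>growth\<close>.\<close>
    have "real k powr (- (1 + \<gamma>)) \<le> real k powr (\<tau> - 1)"
      using elim(1) tau sig_rate(1) by (intro powr_mono) auto
    then have "b * real k powr (- (1 + \<gamma>)) \<le> b * real k powr (\<tau> - 1)"
      using b by (intro mult_left_mono) auto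
    then have "sig k \<le> b * real k powr (\<tau> - 1)"
      using elim(5) params(6)[of k] by simp
    moreover have "(lam (Suc k) - lam k) / 2 \<le> d * real k powr (\<tau> - 1)"
      using elim(4) params(4)[of k] by simp
    ultimately have "growth k \<le> (b + d) * real k powr (\<tau> - 1)"
      unfolding growth_def distrib_right by (rule add_mono)
    then show ?case
      using elim params(3)[of k] by simp
  qed
  then obtain N where N: "\<And>k. k \<ge> N \<Longrightarrow> k \<ge> 1 \<and> c1 * real k powr \<tau> \<le> lam k \<and> lam k \<le> c2 * real k powr \<tau>
      \<and> growth k \<le> (b + d) * real k powr (\<tau> - 1)"
    by (auto simp: eventually_sequentially)
  show thesis
    by (rule that[of c1 c2 "b + d" N]) (use N b c1 c2 d in auto)
qed

text \<open>The iterate moves first, then the multiplier, then the parameter. The updates cost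
  \<open>growth k\<close> times the squared violation at the new iterate plus a multiplier term; the
  lower bound on the excess turns that violation back into excess, giving the factor
  \<open>1 + 4 * growth k / lam k\<close>.\<close>

lemma a_Suc_le:
  assumes Z: "\<And>k. norm (z k) \<le> Z"
    and L: "(L_Psi B Lg g (lam k) (x k) (z k) + Lf) * D\<^sup>2 \<le> L" "L > 0"
  shows "a (Suc k) \<le> (1 + 4 * growth k / lam k) * (a k - min (G k / 2) ((G k)\<^sup>2 / (2 * L)))
      + 5 * ((norm zs)\<^sup>2 + Z\<^sup>2) * growth k / (lam k)\<^sup>2"
proof -
  define l where "l = lam k"
  define y where "y = x (Suc k)"
  \<comment> \<open>The excess after the primal step, still with the old multiplier and
    parameter.\<close>
  define A where "A = excess l y (z k)"
  define P where "P = (norm (pos_part (g y)))\<^sup>2"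
  define E where "E = (norm zs)\<^sup>2 + Z\<^sup>2"
  define t where "t = growth k"
  have l: "l > 0" by (simp add: l_def params)
  have y: "y \<in> effdom h" by (simp add: y_def x_dom)
  have zZ: "(norm (z j))\<^sup>2 \<le> Z\<^sup>2" for j using Z by (intro power_mono) auto
  have "v k \<in> effdom h" using v argmin_dom by (auto simp: aug_argmin_def)
  then have "(norm (v k - x k))\<^sup>2 \<le> D\<^sup>2" using dom_diam x_dom by (intro power_mono) auto
  then have "(L_Psi B Lg g l (x k) (z k) + Lf) * (norm (v k - x k))\<^sup>2 \<le> (L_Psi B Lg g l (x k) (z k) + Lf) * D\<^sup>2"
    using L_Psi_nonneg[OF l] Lf_pos by (intro mult_left_mono add_nonneg_nonneg) auto
  then have "(L_Psi B Lg g (lam k) (x k) (z k) + Lf) * (norm (v k - x k))\<^sup>2 \<le> L"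
    using L by (simp add: l_def)
  from short_step_decrease[OF params(3) x_dom v this L(2)]
  have A: "A \<le> a k - min (G k / 2) ((G k)\<^sup>2 / (2 * L))"
    by (simp add: A_def a_def excess_def G_def y_def x_Suc alp_def l_def)
  have "((norm zs)\<^sup>2 + (norm (z k))\<^sup>2) / l \<le> E / l"
    using zZ[of k] l by (intro divide_right_mono) (auto simp: E_def)
  then have "l / 4 * P - E / l \<le> A"
    using excess_lower_bound[OF l z_ge_0 y, of k] by (simp add: P_def A_def)
  then have P: "P \<le> 4 * A / l + 4 * E / l\<^sup>2"
    using l by (simp add: field_simps power2_eq_square)
  have zl: "(norm (z j))\<^sup>2 / l\<^sup>2 \<le> Z\<^sup>2 / l\<^sup>2" for j
    using zZ[of j] by (intro divide_right_mono) auto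
  have "excess l y (z (Suc k)) \<le> A + sig k * (P + (norm (z k))\<^sup>2 / l\<^sup>2)"
    using excess_multiplier_bound[OF l z_ge_0, of "sig k" y k] params(6)[of k]
    by (simp add: z_Suc A_def P_def l_def y_def)
  also have "\<dots> \<le> A + sig k * (P + Z\<^sup>2 / l\<^sup>2)"
    using zl[of k] params(6)[of k] by (intro add_left_mono mult_left_mono) auto
  finally have 1: "excess l y (z (Suc k)) \<le> A + sig k * (P + Z\<^sup>2 / l\<^sup>2)" .
  \<comment> \<open>Only now does the parameter change, with the new multiplier in place, so both
    update costs refer to the old \<open>l\<close>.\<close>
  have "a (Suc k) \<le> excess l y (z (Suc k)) + (lam (Suc k) - l) / 2 * (P + (norm (z (Suc k)))\<^sup>2 / l\<^sup>2)"
    unfolding a_def P_def y_def using params(4)[of k] l by (intro excess_param_bound z_ge_0) (auto simp: l_def)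
  also have "\<dots> \<le> excess l y (z (Suc k)) + (lam (Suc k) - l) / 2 * (P + Z\<^sup>2 / l\<^sup>2)"
    using zl[of "Suc k"] params(4)[of k] by (intro add_left_mono mult_left_mono) (auto simp: l_def)
  finally have "a (Suc k) \<le> A + sig k * (P + Z\<^sup>2 / l\<^sup>2) + (lam (Suc k) - l) / 2 * (P + Z\<^sup>2 / l\<^sup>2)"
    using 1 by linarith
  also have "\<dots> = A + t * (P + Z\<^sup>2 / l\<^sup>2)"
    by (simp add: t_def growth_def l_def algebra_simps)
  also have "\<dots> \<le> A + t * (4 * A / l + 5 * E / l\<^sup>2)"
  proof -
    have "Z\<^sup>2 / l\<^sup>2 \<le> E / l\<^sup>2" by (intro divide_right_mono) (auto simp: E_def)
    moreover have "5 * E / l\<^sup>2 = 4 * E / l\<^sup>2 + E / l\<^sup>2" by simp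
    ultimately have "P + Z\<^sup>2 / l\<^sup>2 \<le> 4 * A / l + 5 * E / l\<^sup>2" using P by linarith
    then show ?thesis using growth_nonneg by (intro add_left_mono mult_left_mono) (auto simp: t_def)
  qed
  also have "\<dots> = (1 + 4 * t / l) * A + 5 * E * t / l\<^sup>2"
    by (simp add: algebra_simps)
  \<comment> \<open>The factor is nonnegative, so the bound on \<open>A\<close> may be inserted
    whatever its sign.\<close>
  also have "(1 + 4 * t / l) * A \<le> (1 + 4 * t / l) * (a k - min (G k / 2) ((G k)\<^sup>2 / (2 * L)))"
    using A l growth_nonneg[of k] by (intro mult_left_mono) (auto simp: t_def)
  finally show ?thesis by (simp add: t_def l_def E_def)
qed

text \<open>Constraints and multipliers are bounded, so the curvature grows no faster than
  \<open>lam\<close>; constants are absorbed since \<open>k powr \<tau> \<ge> 1\<close>.\<close>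

lemma curvature_bound:
  assumes c2: "c2 > 0" "lam k \<le> c2 * real k powr \<tau>" and k: "k \<ge> 1"
    and M: "M \<ge> 0" "\<And>y i. y \<in> effdom h \<Longrightarrow> \<bar>g y $ i\<bar> \<le> M" and Z: "Z \<ge> 0" "\<And>k. norm (z k) \<le> Z"
  shows "L_Psi B Lg g (lam k) (x k) (z k) + Lf
    \<le> ((\<Sum>i\<in>UNIV. c2 * (B i)\<^sup>2 + Lg i * (c2 * M + Z)) + Lf) * real k powr \<tau>"
proof -
  define q where "q = real k powr \<tau>"
  have q: "q \<ge> 1" using k tau by (simp add: q_def ge_one_powr_ge_zero)
  have "lam k * (B i)\<^sup>2 + Lg i * max (lam k * g (x k) $ i + z k $ i) 0
      \<le> (c2 * (B i)\<^sup>2 + Lg i * (c2 * M + Z)) * q" for i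
  proof -
    have "lam k * g (x k) $ i \<le> lam k * M"
      using M(2)[OF x_dom, of k i] params(3)[of k] by (intro mult_left_mono) auto
    also have "\<dots> \<le> c2 * q * M" using c2 M by (intro mult_right_mono) (auto simp: q_def)
    finally have 1: "lam k * g (x k) $ i \<le> c2 * M * q" by (simp add: mult_ac)
    have "z k $ i \<le> Z"
      using component_le_norm_cart[of "z k" i] Z(2)[of k] by linarith
    also have "\<dots> \<le> Z * q" using Z q by (simp add: mult_left_mono[of 1 q Z, simplified])
    finally have "lam k * g (x k) $ i + z k $ i \<le> (c2 * M + Z) * q"
      using 1 by (simp add: algebra_simps)
    moreover have "0 \<le> (c2 * M + Z) * q" using c2 M Z q by simp
    ultimately have "Lg i * max (lam k * g (x k) $ i + z k $ i) 0 \<le> Lg i * ((c2 * M + Z) * q)"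
      using Lg_pos[of i] by (intro mult_left_mono) auto
    moreover have "lam k * (B i)\<^sup>2 \<le> c2 * q * (B i)\<^sup>2"
      using c2 by (intro mult_right_mono) (auto simp: q_def)
    ultimately show ?thesis by (simp add: algebra_simps)
  qed
  then have "L_Psi B Lg g (lam k) (x k) (z k) \<le> (\<Sum>i\<in>UNIV. c2 * (B i)\<^sup>2 + Lg i * (c2 * M + Z)) * q"
    unfolding L_Psi_def sum_distrib_right by (rule sum_mono)
  moreover have "Lf \<le> Lf * q" using Lf_pos q by simp
  ultimately show ?thesis by (simp add: q_def[symmetric] distrib_right)
qed

lemma recursion: obtains C N where "sublinear_recursion a G (\<lambda>k. 4 * growth k / lam k) C \<tau> N"
proof -
  obtain M where M: "M \<ge> 0" "\<And>y i. y \<in> effdom h \<Longrightarrow> \<bar>g y $ i\<bar> \<le> M" using g_bounded by blast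
  obtain Z where Z: "Z \<ge> 0" "\<And>k. norm (z k) \<le> Z" using z_bounded by blast
  obtain c1 c2 c3 N where c: "c1 > 0" "c2 > 0" "c3 > 0" "N \<ge> 1"
    "\<And>k. k \<ge> N \<Longrightarrow> c1 * real k powr \<tau> \<le> lam k" "\<And>k. k \<ge> N \<Longrightarrow> lam k \<le> c2 * real k powr \<tau>"
    "\<And>k. k \<ge> N \<Longrightarrow> growth k \<le> c3 * real k powr (\<tau> - 1)"
    using parameter_bounds by blast
  define E where "E = (norm zs)\<^sup>2 + Z\<^sup>2"
  define S where "S = (\<Sum>i\<in>UNIV. c2 * (B i)\<^sup>2 + Lg i * (c2 * M + Z)) + Lf"
  \<comment> \<open>The entries bound the curvature, the relative growth and the additive error. The
    first is doubled because the short step decrease has denominator \<open>2 * L\<close>, used with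
    \<open>L = C / 2 * q\<close>.\<close>
  define C where "C = max (2 * (S * D\<^sup>2)) (max (4 * c3 / c1) (5 * E * c3 / c1\<^sup>2))"
  have C: "C > 0" using c by (simp add: C_def less_max_iff_disj)
  have "E \<ge> 0" by (simp add: E_def)
  have "sublinear_recursion a G (\<lambda>k. 4 * growth k / lam k) C \<tau> N"
  proof
    fix k assume k: "k \<ge> N"
    then have k1: "k \<ge> 1" using c by simp
    define q where "q = real k powr \<tau>"
    have q: "q > 0" using k1 by (simp add: q_def)
    have l: "0 < c1 * q" "c1 * q \<le> lam k" "lam k > 0"
      using c q k params by (auto simp: q_def)
    \<comment> \<open>With \<open>growth\<close> of order \<open>q / k\<close> and
      \<open>lam\<close> of order \<open>q\<close>, the relative growth is of order
      \<open>1 / k\<close> and the error of order \<open>1 / (k * q)\<close>.\<close>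
    have t: "0 \<le> growth k" "growth k \<le> c3 * (q / k)"
      using growth_nonneg c(7)[OF k] k1 by (auto simp: q_def powr_diff)
    have "4 * growth k / lam k \<le> 4 * (c3 * (q / k)) / (c1 * q)"
      using l t c by (intro frac_le) auto
    also have "\<dots> = 4 * c3 / c1 / k" using q by simp
    also have "\<dots> \<le> C / k" by (intro divide_right_mono) (auto simp: C_def)
    finally show "4 * growth k / lam k \<le> C / k" .
    show "0 \<le> 4 * growth k / lam k" using l t by simp
    have "5 * E * growth k / (lam k)\<^sup>2 \<le> 5 * E * (c3 * (q / k)) / (c1 * q)\<^sup>2"
      using l t c q \<open>E \<ge> 0\<close> by (intro frac_le mult_left_mono power_mono) auto
    also have "\<dots> = 5 * E * c3 / c1\<^sup>2 * (1 / (k * q))"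
      using q by (simp add: field_simps power2_eq_square)
    also have "\<dots> \<le> C * (1 / (k * q))"
      using q by (intro mult_right_mono) (auto simp: C_def)
    also have "1 / (k * q) = real k powr (- 1 - \<tau>)"
      using k1 by (simp add: q_def powr_diff powr_minus_divide)
    finally have e: "5 * E * growth k / (lam k)\<^sup>2 \<le> C * real k powr (- 1 - \<tau>)" .
    have "(L_Psi B Lg g (lam k) (x k) (z k) + Lf) * D\<^sup>2 \<le> S * q * D\<^sup>2"
      unfolding S_def q_def
      using curvature_bound[OF c(2) c(6)[OF k] k1 M Z] by (intro mult_right_mono) auto
    also have "\<dots> = S * D\<^sup>2 * q" by (simp add: mult_ac)
    also have "\<dots> \<le> C / 2 * q" using q by (intro mult_right_mono) (auto simp: C_def)
    finally have "a (Suc k) \<le> (1 + 4 * growth k / lam k) * (a k - min (G k / 2) ((G k)\<^sup>2 / (2 * (C / 2 * q))))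
      + 5 * E * growth k / (lam k)\<^sup>2"
      unfolding E_def using C q Z by (intro a_Suc_le) auto
    then show "a (Suc k) \<le> (1 + 4 * growth k / lam k) * (a k - min (G k / 2) ((G k)\<^sup>2 / (C * real k powr \<tau>)))
      + C * real k powr (- 1 - \<tau>)"
      using e by (simp add: q_def)
  qed (use C tau a_le_G G_nonneg in auto)
  then show thesis by (rule that)
qed

lemma a_lower_bound: obtains m where "\<And>k. m \<le> a k"
proof -
  obtain Z where Z: "Z \<ge> 0" "\<And>k. norm (z k) \<le> Z" using z_bounded by blast
  have "- (((norm zs)\<^sup>2 + Z\<^sup>2) / lam 0) \<le> a k" for k
  proof -
    have "lam 0 \<le> lam k" using lift_Suc_mono_le[of lam 0 k] params(4) by (simp add: less_imp_le)
    then have "((norm zs)\<^sup>2 + (norm (z k))\<^sup>2) / lam k \<le> ((norm zs)\<^sup>2 + Z\<^sup>2) / lam 0"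
      using Z params(3) by (intro frac_le add_left_mono power_mono) auto
    moreover have "0 \<le> lam k / 4 * (norm (pos_part (g (x k))))\<^sup>2" using params(3)[of k] by simp
    ultimately show ?thesis
      using excess_lower_bound[OF params(3) z_ge_0 x_dom, of k k k] unfolding a_def by linarith
  qed
  then show thesis by (rule that)
qed

section \<open>Vanishing gaps, the rate and cluster points\<close>

lemma gap_vanishing_subseq: obtains r where "strict_mono r" "(G \<circ> r) \<longlonglongrightarrow> 0"
proof -
  obtain C N where "sublinear_recursion a G (\<lambda>k. 4 * growth k / lam k) C \<tau> N" by (rule recursion)
  then interpret sublinear_recursion a G "\<lambda>k. 4 * growth k / lam k" C \<tau> N .
  obtain m where "\<And>k. m \<le> a k" using a_lower_bound by blast
  then show thesis
    using subseq_tendsto_0[of G] gap_frequently_small[of m] G_nonneg that by blast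
qed

text \<open>The squared violation is at most of the order of the excess bound over
  \<open>lam k\<close> plus \<open>1 / (lam k)\<^sup>2\<close>. As \<open>1 / lam k\<close> is
  itself of order \<open>k powr (- s)\<close>, the violation has that order as well. It bounds the
  objective error from below, and the excess bounds it from above.\<close>

lemma error_bound:
  obtains K N where "\<And>k. k \<ge> N \<Longrightarrow>
    max \<bar>f (x k) + hr (x k) - opt\<bar> (norm (pos_part (g (x k)))) \<le> K * real k powr (- min \<tau> (1 - \<tau>))"
proof -
  define s where "s = min \<tau> (1 - \<tau>)"
  have s: "0 \<le> s" "s \<le> \<tau>" "s \<le> 1 - \<tau>" using tau by (auto simp: s_def)
  obtain C N1 where "sublinear_recursion a G (\<lambda>k. 4 * growth k / lam k) C \<tau> N1" by (rule recursion)
  then obtain K N2 where K: "K > 0" "\<And>k. k \<ge> N2 \<Longrightarrow> a k \<le> K * real k powr (- s)"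
    using sublinear_recursion.rate s by blast
  obtain Z where Z: "Z \<ge> 0" "\<And>k. norm (z k) \<le> Z" using z_bounded by blast
  obtain c1 N3 where c: "c1 > 0" "N3 \<ge> 1" "\<And>k. k \<ge> N3 \<Longrightarrow> c1 * real k powr \<tau> \<le> lam k"
    using parameter_bounds by metis
  define E where "E = (norm zs)\<^sup>2 + Z\<^sup>2"
  define Q where "Q = sqrt (4 * K / c1 + 4 * E / c1\<^sup>2)"
  have E: "E \<ge> 0" by (simp add: E_def)
  have Q: "Q \<ge> 0" using K c E by (simp add: Q_def)
  \<comment> \<open>The entries come from the upper objective bound, the lower objective bound and
    the violation.\<close>
  define K' where "K' = max (K + Z\<^sup>2 / (2 * c1)) (max (norm zs * Q) Q)"
  have "max \<bar>f (x k) + hr (x k) - opt\<bar> (norm (pos_part (g (x k)))) \<le> K' * real k powr (- s)"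
    if "k \<ge> max N2 N3" for k
  proof -
    have k: "k \<ge> N2" "k \<ge> N3" "k \<ge> 1" using that c by auto
    define q where "q = real k powr (- s)"
    define P where "P = norm (pos_part (g (x k)))"
    have q: "q > 0" using k by (simp add: q_def)
    have l: "lam k > 0" by (rule params)
    have "1 / lam k \<le> 1 / (c1 * real k powr \<tau>)"
      using c k by (intro divide_left_mono) (auto simp: params intro!: mult_pos_pos)
    also have "\<dots> = 1 / c1 * real k powr (- \<tau>)" using k by (simp add: powr_minus_divide)
    also have "\<dots> \<le> 1 / c1 * q"
      unfolding q_def using c k s by (intro mult_left_mono powr_mono) auto
    finally have lq: "1 / lam k \<le> q / c1" by simp
    have zZ: "(norm (z k))\<^sup>2 \<le> Z\<^sup>2" using Z by (intro power_mono) auto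
    then have "((norm zs)\<^sup>2 + (norm (z k))\<^sup>2) / lam k \<le> E / lam k"
      using l by (intro divide_right_mono) (auto simp: E_def)
    then have "lam k / 4 * P\<^sup>2 - E / lam k \<le> K * q"
      using excess_lower_bound[OF l z_ge_0 x_dom, of k k] K(2)[OF k(1)] by (simp add: a_def P_def q_def)
    then have "P\<^sup>2 \<le> 4 * (K * q) * (1 / lam k) + 4 * E * (1 / lam k)\<^sup>2"
      using l by (simp add: field_simps power2_eq_square)
    also have "\<dots> \<le> 4 * (K * q) * (q / c1) + 4 * E * (q / c1)\<^sup>2"
      using lq l K q E by (intro add_mono mult_left_mono power_mono) auto
    also have "\<dots> = (4 * K / c1 + 4 * E / c1\<^sup>2) * q\<^sup>2"
      by (simp add: power_divide power2_eq_square algebra_simps)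
    also have "\<dots> = (Q * q)\<^sup>2"
      using K c E by (simp add: Q_def power_mult_distrib)
    finally have P: "P \<le> Q * q"
      by (rule power2_le_imp_le) (use Q q in simp)
    also have "\<dots> \<le> K' * q" using q by (intro mult_right_mono) (auto simp: K'_def)
    finally have 1: "P \<le> K' * q" .
    have "norm zs * P \<le> norm zs * (Q * q)" using P by (intro mult_left_mono) auto
    also have "\<dots> = (norm zs * Q) * q" by simp
    also have "\<dots> \<le> K' * q" using q by (intro mult_right_mono) (auto simp: K'_def)
    finally have 2: "- (K' * q) \<le> f (x k) + hr (x k) - opt"
      using objective_ge[OF x_dom, of k] by (simp add: P_def)
    have "(norm (z k))\<^sup>2 / (2 * lam k) \<le> Z\<^sup>2 / 2 * (1 / lam k)"
      using zZ l by (simp add: divide_right_mono)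
    also have "\<dots> \<le> Z\<^sup>2 / 2 * (q / c1)" using lq by (intro mult_left_mono) auto
    finally have "f (x k) + hr (x k) - opt \<le> K * q + Z\<^sup>2 / 2 * (q / c1)"
      using objective_le[OF l, of "x k" "z k"] K(2)[OF k(1)] by (simp add: a_def q_def)
    also have "\<dots> = (K + Z\<^sup>2 / (2 * c1)) * q" by (simp add: algebra_simps)
    also have "\<dots> \<le> K' * q" using q by (intro mult_right_mono) (auto simp: K'_def)
    finally show ?thesis using 1 2 by (simp add: P_def q_def abs_le_iff)
  qed
  then show thesis using that[of "max N2 N3" K'] by (simp add: s_def)
qed

text \<open>Vanishing gaps give stationarity in the limit and the rate gives feasibility. If
  \<open>w $ i > 0\<close>, the positive part is eventually unclipped, so
  \<open>g (x (r n)) $ i\<close> is at least \<open>- Z / lam (r n)\<close>, which tends to 0, and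
  complementarity follows.\<close>

lemma cluster_point_kkt:
  assumes r: "strict_mono r" "(G \<circ> r) \<longlonglongrightarrow> 0"
    and X: "(\<lambda>n. x (r n)) \<longlonglongrightarrow> y"
    and W: "(\<lambda>n. pos_part (lam (r n) *\<^sub>R g (x (r n)) + z (r n))) \<longlonglongrightarrow> w"
  shows "kkt_point f h g y w"
proof -
  define W where "W n = pos_part (lam (r n) *\<^sub>R g (x (r n)) + z (r n))" for n
  have Wi: "(\<lambda>n. max (lam (r n) * g (x (r n)) $ i + z (r n) $ i) 0) \<longlonglongrightarrow> w $ i" for i
    using tendsto_vec_nth[OF W, of i] by (simp add: pos_part_def)
  have gi: "(\<lambda>n. g (x (r n)) $ i) \<longlonglongrightarrow> g y $ i" for i
    by (rule g_tendsto[OF X])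
  have gap: "(grad f (x (r n)) + (\<Sum>i\<in>UNIV. W n $ i *\<^sub>R grad (\<lambda>y. g y $ i) (x (r n)))) \<bullet> (x (r n) - u)
      + hr (x (r n)) - hr u \<le> (G \<circ> r) n" if "u \<in> effdom h" for n u
    \<comment> \<open>Since \<open>v\<close> minimizes the linearized problem, \<open>G\<close>
      dominates the linearized decrease towards every \<open>u\<close> in the domain.\<close>
    using argmin_le[OF v[of "r n", unfolded aug_argmin_def] that]
    by (simp add: G_def inner_diff_right grad_F_eq[OF params(3)] W_def pos_part_def)
  have sub: "- (grad f y + (\<Sum>i\<in>UNIV. w $ i *\<^sub>R grad (\<lambda>y. g y $ i) y)) \<in> subdifferential h y"
    using limit_stationary(2)[OF x_dom X W[folded W_def] r(2) gap] .
  have w: "0 \<le> w $ i" for i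
    by (rule tendsto_lowerbound[OF Wi]) auto
  have g0: "g y $ i \<le> 0" for i
  proof -
    obtain K N where K: "\<And>k. k \<ge> N \<Longrightarrow>
        max \<bar>f (x k) + hr (x k) - opt\<bar> (norm (pos_part (g (x k)))) \<le> K * real k powr (- min \<tau> (1 - \<tau>))"
      using error_bound by blast
    have "(\<lambda>k. real k powr (- min \<tau> (1 - \<tau>))) \<longlonglongrightarrow> 0"
      using tau by (intro tendsto_neg_powr filterlim_real_sequentially) auto
    then have "(\<lambda>k. K * real k powr (- min \<tau> (1 - \<tau>))) \<longlonglongrightarrow> K * 0"
      by (intro tendsto_intros)
    then have lim: "(\<lambda>n. K * real (r n) powr (- min \<tau> (1 - \<tau>))) \<longlonglongrightarrow> 0"
      using LIMSEQ_subseq_LIMSEQ[OF _ r(1)] by (fastforce simp: o_def)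
    show ?thesis
    proof (rule tendsto_le[OF _ lim gi])
      show "\<forall>\<^sub>F n in sequentially. g (x (r n)) $ i \<le> K * real (r n) powr (- min \<tau> (1 - \<tau>))"
        using eventually_ge_at_top[of N]
      proof eventually_elim
        case (elim n)
        then have "N \<le> r n" using strict_mono_imp_increasing[OF r(1), of n] by simp
        then show ?case
          using K[of "r n"] component_le_norm_cart[of "pos_part (g (x (r n)))" i]
          by (simp add: pos_part_def)
      qed
    qed simp
  qed
  have comp: "w $ i * g y $ i = 0" for i
  proof (cases "w $ i = 0")
    case False
    obtain Z where Z: "Z \<ge> 0" "\<And>k. norm (z k) \<le> Z" using z_bounded by blast
    have "filterlim (\<lambda>n. lam (r n)) at_top sequentially"
      using filterlim_compose[OF params(5) filterlim_subseq[OF r(1)]] .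
    then have lim: "(\<lambda>n. - Z / lam (r n)) \<longlonglongrightarrow> 0"
      by (intro tendsto_divide_0[OF tendsto_const] filterlim_at_top_imp_at_infinity)
    have "0 < w $ i" using w[of i] False by simp
    then have "\<forall>\<^sub>F n in sequentially. 0 < max (lam (r n) * g (x (r n)) $ i + z (r n) $ i) 0"
      using order_tendstoD(1)[OF Wi] by blast
    then have "\<forall>\<^sub>F n in sequentially. - Z / lam (r n) \<le> g (x (r n)) $ i"
    proof eventually_elim
      case (elim n)
      have "z (r n) $ i \<le> Z"
        using component_le_norm_cart[of "z (r n)" i] Z(2)[of "r n"] by linarith
      then show ?case using elim params(3)[of "r n"] by (simp add: less_max_iff_disj field_simps)
    qed
    then have "0 \<le> g y $ i" by (rule tendsto_le[OF _ gi lim, rotated]) simp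
    then show ?thesis using g0[of i] by simp
  qed simp
  have "0 = grad f y + - (grad f y + (\<Sum>i\<in>UNIV. w $ i *\<^sub>R grad (\<lambda>y. g y $ i) y))
      + (\<Sum>i\<in>UNIV. w $ i *\<^sub>R grad (\<lambda>y. g y $ i) y)" by simp
  then have "0 \<in> (\<lambda>s. grad f y + s + (\<Sum>i\<in>UNIV. w $ i *\<^sub>R grad (\<lambda>y. g y $ i) y)) ` subdifferential h y"
    using sub by (rule image_eqI)
  moreover have "w \<bullet> g y = 0"
    by (simp only: inner_vec_def inner_real_def comp sum.neutral_const)
  ultimately show ?thesis
    using g0 w by (simp add: kkt_point_def less_eq_vec_def)
qed

end

section \<open>Convergence rate and KKT cluster points of the single-loop algorithm\<close>

theorem theorem4p2:
  fixes f :: "real ^ 'n \<Rightarrow> real" and h :: "real ^ 'n \<Rightarrow> ereal"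
    and g :: "real ^ 'n \<Rightarrow> real ^ 'm"
    and Lf D \<tau> \<gamma> :: real and Lg B :: "'m \<Rightarrow> real"
    and lam sig alp :: "nat \<Rightarrow> real"
    and x v :: "nat \<Rightarrow> real ^ 'n" and z :: "nat \<Rightarrow> real ^ 'm"
  assumes f: "convex_on UNIV f" "\<forall>y. f differentiable (at y)"
      "Lf > 0" "Lf-lipschitz_on UNIV (grad f)"
    and h: "proper_fun h" "closed_fun h" "convex_fun h"
      "D > 0" "\<forall>y\<in>effdom h. \<forall>y'\<in>effdom h. norm (y - y') \<le> D"
      "\<forall>u. lin_argmin h u \<noteq> {}"
    and g: "\<forall>i. convex_on UNIV (\<lambda>y. g y $ i)" "\<forall>i y. (\<lambda>y. g y $ i) differentiable (at y)"
      "\<forall>i. Lg i > 0" "\<forall>i. (Lg i)-lipschitz_on (effdom h) (grad (\<lambda>y. g y $ i))"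
    and kkt: "\<exists>y w. kkt_point f h g y w"
    and B: "\<forall>i. B i > 0" "\<forall>i. \<forall>y\<in>effdom h. norm (grad (\<lambda>y. g y $ i) y) \<le> B i"
      "\<forall>i. (B i)-lipschitz_on (effdom h) (\<lambda>y. g y $ i)"
    and alg: "single_loop f h g lam sig alp x z v"
    and \<tau>: "0 < \<tau>" "\<tau> < 1"
    and lam: "lam \<in> \<Theta>(\<lambda>k. real k powr \<tau>)"
      "(\<lambda>k. lam (Suc k) - lam k) \<in> O(\<lambda>k. real k powr (- (1 - \<tau>)))"
    and alp: "\<forall>k. alp k = short_step f h g Lf Lg B (x k) (z k) (v k) (lam k)"
    and sig: "\<gamma> > 0" "sig \<in> \<Theta>(\<lambda>k. real k powr (- (1 + \<gamma>)))"
  shows "(\<forall>k. err f h g (x k) < \<infinity>) \<and>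
     (\<lambda>k. real_of_ereal (err f h g (x k)))
       \<in> O(\<lambda>k. max (real k powr (- 1 / 2)) (max (real k powr (- (1 - \<tau>))) (real k powr (- \<tau>)))) \<and>
     (slater h g \<longrightarrow>
       (\<exists>r. strict_mono r \<and>
         (\<forall>y w. seq_cluster_point
              ((\<lambda>k. (x k, pos_part (lam k *\<^sub>R g (x k) + z k))) \<circ> r) (y, w)
            \<longrightarrow> kkt_point f h g y w)))"
proof -
  obtain xs zs where kktp: "kkt_point f h g xs zs" using kkt by blast
  interpret single_loop_run f h g Lf D Lg B xs zs lam sig alp x v z \<tau> \<gamma>
    by unfold_locales (use f h g B alg \<tau> lam alp sig kktp in auto)
  let ?s = "min \<tau> (1 - \<tau>)"
  let ?err = "\<lambda>k. max \<bar>f (x k) + hr (x k) - opt\<bar> (norm (pos_part (g (x k))))"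
  have err: "err f h g (x k) = ereal (?err k)" for k
    by (rule err_eq[OF x_dom])
  obtain K N where K: "\<And>k. k \<ge> N \<Longrightarrow> ?err k \<le> K * real k powr (- ?s)"
    using error_bound by blast
  have "?err \<in> O(\<lambda>k. max (real k powr (- 1 / 2)) (max (real k powr (- (1 - \<tau>))) (real k powr (- \<tau>))))"
  proof (rule bigoI[where c = "\<bar>K\<bar>"])
    show "\<forall>\<^sub>F k in sequentially. norm (?err k)
        \<le> \<bar>K\<bar> * norm (max (real k powr (- 1 / 2)) (max (real k powr (- (1 - \<tau>))) (real k powr (- \<tau>))))"
      using eventually_ge_at_top[of N]
    proof eventually_elim
      case (elim k)
      let ?m = "max (real k powr (- 1 / 2)) (max (real k powr (- (1 - \<tau>))) (real k powr (- \<tau>)))"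
      \<comment> \<open>The exponent \<open>?s\<close> is one of \<tau> and
        \<open>1 - \<tau>\<close>, so this power is one of the last two entries of the
        maximum.\<close>
      have m: "real k powr (- ?s) \<le> ?m"
        by (cases "\<tau> \<le> 1 - \<tau>") (simp_all add: min_def le_max_iff_disj)
      have "K * real k powr (- ?s) \<le> \<bar>K\<bar> * real k powr (- ?s)"
        by (intro mult_right_mono) auto
      also have "\<dots> \<le> \<bar>K\<bar> * ?m" by (intro mult_left_mono m) auto
      also have "?m = norm ?m"
        using order_trans[OF powr_ge_zero m] by simp
      finally have "?err k \<le> \<bar>K\<bar> * norm ?m" using K[OF elim] by linarith
      moreover have "norm (?err k) = ?err k" by (simp add: le_max_iff_disj)
      ultimately show ?case by linarith
    qed
  qed
  then have rate: "(\<lambda>k. real_of_ereal (err f h g (x k)))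
      \<in> O(\<lambda>k. max (real k powr (- 1 / 2)) (max (real k powr (- (1 - \<tau>))) (real k powr (- \<tau>))))"
    unfolding err real_of_ereal.simps .
  \<comment> \<open>The subsequence is fixed before any cluster point is considered; the gaps still
    vanish along each further subsequence.\<close>
  obtain r where r: "strict_mono r" "(G \<circ> r) \<longlonglongrightarrow> 0" by (rule gap_vanishing_subseq)
  have "kkt_point f h g y w"
    if cluster: "seq_cluster_point ((\<lambda>k. (x k, pos_part (lam k *\<^sub>R g (x k) + z k))) \<circ> r) (y, w)" for y w
  proof -
    obtain t where t: "strict_mono t"
      "((\<lambda>k. (x k, pos_part (lam k *\<^sub>R g (x k) + z k))) \<circ> r \<circ> t) \<longlonglongrightarrow> (y, w)"
      using cluster by (auto simp: seq_cluster_point_def)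
    show ?thesis
    proof (rule cluster_point_kkt)
      show "strict_mono (r \<circ> t)" using r(1) t(1) by (rule strict_mono_o)
      show "(G \<circ> (r \<circ> t)) \<longlonglongrightarrow> 0"
        using LIMSEQ_subseq_LIMSEQ[OF r(2) t(1)] by (simp add: o_assoc)
      show "(\<lambda>n. x ((r \<circ> t) n)) \<longlonglongrightarrow> y"
        using tendsto_fst[OF t(2)] by (simp add: o_def)
      show "(\<lambda>n. pos_part (lam ((r \<circ> t) n) *\<^sub>R g (x ((r \<circ> t) n)) + z ((r \<circ> t) n))) \<longlonglongrightarrow> w"
        using tendsto_snd[OF t(2)] by (simp add: o_def)
    qed
  qed
  moreover have "err f h g (x k) < \<infinity>" for k
    unfolding err less_ereal.simps ..
  ultimately show ?thesis
    using rate r(1) by blast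
qed

end
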